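(* Let $n\ge 1$ be a finite horizon, $\lambda\in(0,1]$, and consider the $n$-stage $\lambda$-discounted primal game $\Gamma_{n,\lambda}(p,q)$ with value $v_{n,\lambda}(p,q)$. (Player 1.) The value satisfies $$v_{n,\lambda}(p,q)=\max_{R}\max_{U}\ \sum_{l\in\mathcal L}q(l)\,U_{\mathcal J_1}\qquad(\text{with }\mathcal J_1=\{l\})$$ where the maximum is over real variables $R_{\mathcal I_t}(a_t)$ (for all $t=1,\dots,n$, all $\mathcal I_t$, all $a_t\in\mathcal A$) and $U_{\mathcal J_t}$ (for all $t=1,\dots,n+1$, all $\mathcal J_t$) subject to $$\sum_{k_1,\dots,k_t}\sum_{a_t}R_{\mathcal I_t}(a_t)\lambda^{t-1}G_{k_t,l_t}(a_t,b_t)+\sum_{l_{t+1}}\sum_{a_t}Q_{a_t,b_t}(l_t,l_{t+1})U_{\mathcal J_{t+1}}\ \ge\ U_{\mathcal J_t}\quad\forall t=1,\dots,n,\ \forall b_t,\ \forall \mathcal J_t,$$ $$\sum_{a_t}R_{\mathcal I_t}(a_t)=P_{a_{t-1},b_{t-1}}(k_{t-1},k_t)R_{\mathcal I_{t-1}}(a_{t-1})\quad\forall t=1,\dots,n,\ \forall \mathcal I_t,$$ $$U_{\mathcal J_{n+1}}=0\ \ \forall\mathcal J_{n+1},\qquad R_{\mathcal I_t}(a_t)\ge 0\ \ \forall t,\mathcal I_t,a_t,$$ where $\mathcal J_{t+1}=(\mathcal J_t,a_t,b_t,l_{t+1})$. If $(R^*,U^* )$ is an optimal solution, then $$\sigma_t^{*a_t}(\mathcal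 I_t)=\frac{R^*_{\mathcal I_t}(a_t)}{P_{a_{t-1},b_{t-1}}(k_{t-1},k_t)R^*_{\mathcal I_{t-1}}(a_{t-1})}$$ (at $\mathcal I_t$ where the denominator is nonzero; arbitrary elsewhere) is the optimal (security) strategy of player 1 in $\Gamma_{n,\lambda}(p,q)$, and the initial vector payoff $\nu^*=-\alpha(\sigma^* )$ of the type 2 dual game is given, for every $l\in\mathcal L$, by $$\nu^*_l=-\alpha_l(\sigma^* )=-U^*_{\mathcal J_1},\qquad \mathcal J_1=\{l\}.$$ (Player 2.) Similarly, $$v_{n,\lambda}(p,q)=\min_S\min_Z\ \sum_{k\in\mathcal K}p(k)Z_{\mathcal I_1}\qquad(\text{with }\mathcal I_1=\{k\})$$ over real variables $S_{\mathcal J_t}(b_t)$ ($t=1,\dots,n$) and $Z_{\mathcal I_t}$ ($t=1,\dots,n+1$) subject to $$\sum_{l_1,\dots,l_t}\sum_{b_t}S_{\mathcal J_t}(b_t)\lambda^{t-1}G_{k_t,l_t}(a_t,b_t)+\sum_{k_{t+1}}\sum_{b_t}P_{a_t,b_t}(k_t,k_{t+1})Z_{\mathcal I_{t+1}}\ \le\ Z_{\mathcal I_t}\quad\forall t=1,\dots,n,\ \forall a_t,\ \forall\mathcal I_t,$$ $$\sum_{b_t}S_{\mathcal J_t}(b_t)=Q_{a_{t-1},b_{t-1}}(l_{t-1},l_t)S_{\mathcal J_{t-1}}(b_{t-1})\quad\forall t=1,\dots,n,\ \forall\mathcal J_t,$$ $$Z_{\mathcal I_{n+1}}=0\ \ \forall\mathcal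 I_{n+1},\qquad S_{\mathcal J_t}(b_t)\ge0\ \ \forall t,\mathcal J_t,b_t,$$ where $\mathcal I_{t+1}=(\mathcal I_t,a_t,b_t,k_{t+1})$. If $(S^*,Z^* )$ is an optimal solution, then $$\tau_t^{*b_t}(\mathcal J_t)=\frac{S^*_{\mathcal J_t}(b_t)}{Q_{a_{t-1},b_{t-1}}(l_{t-1},l_t)S^*_{\mathcal J_{t-1}}(b_{t-1})}$$ (at $\mathcal J_t$ where the denominator is nonzero; arbitrary elsewhere) is the optimal (security) strategy of player 2 in $\Gamma_{n,\lambda}(p,q)$, and the initial vector payoff $\mu^*=-\beta(\tau^* )$ of the type 1 dual game is given, for every $k\in\mathcal K$, by $$\mu^*_k=-\beta_k(\tau^* )=-Z^*_{\mathcal I_1},\qquad \mathcal I_1=\{k\}.$$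
   Context: Game. $\mathcal K,\mathcal L$ (states of players 1, 2) and $\mathcal A,\mathcal B$ (actions of players 1, 2) are non-empty finite sets. $G_{k,l}\in\mathbb R^{|\mathcal A|\times|\mathcal B|}$ has non-negative entries $G_{k,l}(a,b)$ (payoff to player 1, cost to player 2). $p\in\Delta(\mathcal K)$, $q\in\Delta(\mathcal L)$ are initial distributions ($\Delta(\cdot)$ = set of probability distributions). For each $(a,b)$, $P_{a,b}(k,k')$ and $Q_{a,b}(l,l')$ are transition probabilities (row-stochastic in $k'$, resp. $l'$). At stage 1, $k_1\sim p$ and $l_1\sim q$ are drawn independently; for $t\ge2$, $k_t$ and $l_t$ are drawn independently according to $P_{a_{t-1},b_{t-1}}(k_{t-1},\cdot)$ and $Q_{a_{t-1},b_{t-1}}(l_{t-1},\cdot)$. Player 1 sees only the states $k_t$, player 2 only the states $l_t$. At every stage the players choose $a_t,b_t$ simultaneously, and both then observe $(a_t,b_t)$. Payoffs are not observed during play. Information and strategies. $\mathcal I_t=(k_1,a_1,b_1,\dots,k_{t-1},a_{t-1},b_{t-1},k_t)$ and $\mathcal J_t=(l_1,a_1,b_1,\dots,l_{t-1},a_{t-1},b_{t-1},l_t)$ are the information of players 1 and 2 at stage $t$. Behavior strategies are $\sigma=(\sigma_t)$, $\tau=(\tau_t)$ with $\sigma_t(\mathcal I_t)\in\Delta(\mathcal A)$, $\tau_t(\mathcal J_t)\in\Delta(\mathcal B)$; $\sigma_t^{a}(\mathcal I_t)$, $\tau_t^{b}(\mathcal J_t)$ are the probabilities of $a$, $b$. Value.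 The payoff of $\Gamma_{n,\lambda}(p,q)$ is $\gamma_{n,\lambda}(p,q,\sigma,\tau)=E_{p,q,\sigma,\tau}\big(\sum_{t=1}^n\lambda^{t-1}G_{k_t,l_t}(a_t,b_t)\big)$; player 1 maximizes, player 2 minimizes. The game has a value $v_{n,\lambda}(p,q)=\max_\sigma\min_\tau\gamma_{n,\lambda}=\min_\tau\max_\sigma\gamma_{n,\lambda}$; an optimal (security) strategy of player 1 (player 2) is one attaining the outer max (outer min). Vector payoffs. $\alpha_l(\sigma)=\min_\tau E_{p,q,\sigma,\tau}\big(\sum_{t=1}^n\lambda^{t-1}G_{k_t,l_t}(a_t,b_t)\,\big|\,l_1=l\big)$ for $l\in\mathcal L$, and $\beta_k(\tau)=\max_\sigma E_{p,q,\sigma,\tau}\big(\sum_{t=1}^n\lambda^{t-1}G_{k_t,l_t}(a_t,b_t)\,\big|\,k_1=k\big)$ for $k\in\mathcal K$ (conditioning on $l_1=l$, resp. $k_1=k$, means that the play starts with that initial state). The vectors $\nu^*=-\alpha(\sigma^* )$ and $\mu^*=-\beta(\tau^* )$, with $\alpha(\sigma)=(\alpha_l(\sigma))_{l\in\mathcal L}$ and $\beta(\tau)=(\beta_k(\tau))_{k\in\mathcal K}$, are called the initial vector payoffs of the type 2 and type 1 dual games. Conventions. $R_{\mathcal I_0}(a_0)=p(k_1)$, $P_{a_0,b_0}(k_0,k_1)=1$, $S_{\mathcal J_0}(b_0)=q(l_1)$, $Q_{a_0,b_0}(l_0,l_1)=1$. In $\sum_{k_1,\dots,k_t}R_{\mathcal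 I_t}(a_t)$ with $\mathcal J_t$ fixed, $\mathcal I_t$ is formed from $k_1,\dots,k_t$ and the actions $a_1,b_1,\dots,a_{t-1},b_{t-1}$ contained in $\mathcal J_t$; symmetrically for $\sum_{l_1,\dots,l_t}S_{\mathcal J_t}(b_t)$ with $\mathcal I_t$ fixed. For $\mathcal I_t$ with $t\ge2$, $\mathcal I_{t-1}$ and $a_{t-1},b_{t-1},k_{t-1}$ are those contained in $\mathcal I_t$ (similarly for $\mathcal J_t$).
   Formalization: ν*_l = −U*_{J_1} is proved for every optimal (R*,U* ) only where q(l)>0 (it fails if q(l)=0, as U*_{J_1} can be lowered freely); for all l it holds for some optimal (R*,U') with the same R*. Likewise μ*_k = −Z*_{I_1} where p(k)>0. *)

theory Defs
  imports "HOL-Probability.Probability"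
begin

(*
  A private history pairs the chronological list of the past (own state, a, b) with the current
  own state, so one with past h belongs to stage length h + 1.  Stages are counted from 1 and the
  discount factor of that stage is lam ^ length h.
*)

type_synonym ('s, 'a, 'b) history = "('s \<times> 'a \<times> 'b) list \<times> 's"

type_synonym ('k, 'a, 'b) strategy1 = "('k, 'a, 'b) history \<Rightarrow> 'a pmf"
type_synonym ('l, 'a, 'b) strategy2 = "('l, 'a, 'b) history \<Rightarrow> 'b pmf"

definition view1 :: "('k \<times> 'l \<times> 'a \<times> 'b) list \<Rightarrow> ('k \<times> 'a \<times> 'b) list" where
  "view1 h = map (\<lambda>(k, l, a, b). (k, a, b)) h"

definition view2 :: "('k \<times> 'l \<times> 'a \<times> 'b) list \<Rightarrow> ('l \<times> 'a \<times> 'b) list" where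
  "view2 h = map (\<lambda>(k, l, a, b). (l, a, b)) h"

(* Joint law of the first t stages and of the two states at the beginning of stage t + 1. *)
primrec play ::
  "('a \<Rightarrow> 'b \<Rightarrow> 'k \<Rightarrow> 'k pmf) \<Rightarrow> ('a \<Rightarrow> 'b \<Rightarrow> 'l \<Rightarrow> 'l pmf) \<Rightarrow> 'k pmf \<Rightarrow> 'l pmf \<Rightarrow>
   ('k, 'a, 'b) strategy1 \<Rightarrow> ('l, 'a, 'b) strategy2 \<Rightarrow> nat \<Rightarrow>
   (('k \<times> 'l \<times> 'a \<times> 'b) list \<times> 'k \<times> 'l) pmf" where
  "play P Q p q \<sigma> \<tau> 0 =
     do { k \<leftarrow> p; l \<leftarrow> q; return_pmf ([], k, l) }"
| "play P Q p q \<sigma> \<tau> (Suc t) =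
     do { (h, k, l) \<leftarrow> play P Q p q \<sigma> \<tau> t;
          a \<leftarrow> \<sigma> (view1 h, k);
          b \<leftarrow> \<tau> (view2 h, l);
          k' \<leftarrow> P a b k;
          l' \<leftarrow> Q a b l;
          return_pmf (h @ [(k, l, a, b)], k', l') }"

definition discounted_sum ::
  "('k \<Rightarrow> 'l \<Rightarrow> 'a \<Rightarrow> 'b \<Rightarrow> real) \<Rightarrow> real \<Rightarrow> nat \<Rightarrow> ('k \<times> 'l \<times> 'a \<times> 'b) list \<Rightarrow> real" where
  "discounted_sum G lam n h =
     (\<Sum>t = 1..n. lam ^ (t - 1) * (case h ! (t - 1) of (k, l, a, b) \<Rightarrow> G k l a b))"

definition payoff ::
  "('k \<Rightarrow> 'l \<Rightarrow> 'a \<Rightarrow> 'b \<Rightarrow> real) \<Rightarrow> ('a \<Rightarrow> 'b \<Rightarrow> 'k \<Rightarrow> 'k pmf) \<Rightarrow> ('a \<Rightarrow> 'b \<Rightarrow> 'l \<Rightarrow> 'l pmf) \<Rightarrow>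
   real \<Rightarrow> nat \<Rightarrow> 'k pmf \<Rightarrow> 'l pmf \<Rightarrow>
   ('k, 'a, 'b) strategy1 \<Rightarrow> ('l, 'a, 'b) strategy2 \<Rightarrow> real" where
  "payoff G P Q lam n p q \<sigma> \<tau> =
     measure_pmf.expectation (play P Q p q \<sigma> \<tau> n) (\<lambda>(h, _). discounted_sum G lam n h)"

definition is_maximum :: "real set \<Rightarrow> real \<Rightarrow> bool" where
  "is_maximum S m \<longleftrightarrow> m \<in> S \<and> (\<forall>x\<in>S. x \<le> m)"

definition is_minimum :: "real set \<Rightarrow> real \<Rightarrow> bool" where
  "is_minimum S m \<longleftrightarrow> m \<in> S \<and> (\<forall>x\<in>S. m \<le> x)"

(*
  LEAST and GREATEST are the attained minimum and maximum (not infimum and supremum).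
*)
definition guarantee1 where
  "guarantee1 G P Q lam n p q \<sigma> = (LEAST x. x \<in> range (\<lambda>\<tau>. payoff G P Q lam n p q \<sigma> \<tau>))"

definition guarantee2 where
  "guarantee2 G P Q lam n p q \<tau> = (GREATEST x. x \<in> range (\<lambda>\<sigma>. payoff G P Q lam n p q \<sigma> \<tau>))"

definition game_value where
  "game_value G P Q lam n p q = (GREATEST x. x \<in> range (\<lambda>\<sigma>. guarantee1 G P Q lam n p q \<sigma>))"

definition has_value where
  "has_value G P Q lam n p q v \<longleftrightarrow>
     is_maximum (range (\<lambda>\<sigma>. guarantee1 G P Q lam n p q \<sigma>)) v \<and>
     is_minimum (range (\<lambda>\<tau>. guarantee2 G P Q lam n p q \<tau>)) v"

definition optimal1 where
  "optimal1 G P Q lam n p q \<sigma> \<longleftrightarrow>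
     is_arg_max (\<lambda>\<sigma>. guarantee1 G P Q lam n p q \<sigma>) (\<lambda>_. True) \<sigma>"

definition optimal2 where
  "optimal2 G P Q lam n p q \<tau> \<longleftrightarrow>
     is_arg_min (\<lambda>\<tau>. guarantee2 G P Q lam n p q \<tau>) (\<lambda>_. True) \<tau>"

(*
  Conditioning on the initial state of one player is starting the play from that state; the
  other player's initial state keeps its law because the two are drawn independently.
*)
definition alpha where
  "alpha G P Q lam n p \<sigma> l =
     (LEAST x. x \<in> range (\<lambda>\<tau>. payoff G P Q lam n p (return_pmf l) \<sigma> \<tau>))"

definition beta where
  "beta G P Q lam n q \<tau> k =
     (GREATEST x. x \<in> range (\<lambda>\<sigma>. payoff G P Q lam n (return_pmf k) q \<sigma> \<tau>))"

(* nu is the initial vector payoff of the type 2 dual game, mu that of the type 1 dual game. *)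
definition nu where
  "nu G P Q lam n p \<sigma> l = - alpha G P Q lam n p \<sigma> l"

definition mu where
  "mu G P Q lam n q \<tau> k = - beta G P Q lam n q \<tau> k"

(*
  Histories of the opponent with the same actions as the given history: its stage and all
  actions are fixed, while the opponent's states, including the current one, are free.
*)
definition matching :: "('s, 'a, 'b) history \<Rightarrow> ('r, 'a, 'b) history set" where
  "matching I = {J. map snd (fst J) = map snd (fst I)}"

(*
  inflow1 p P R I is P_{a,b}(k, k') R_I'(a), where I' is the predecessor of I and k, a, b are the
  last entries of the past of I; at stage 1 it is p k'.
*)
definition inflow1 ::
  "'k pmf \<Rightarrow> ('a \<Rightarrow> 'b \<Rightarrow> 'k \<Rightarrow> 'k pmf) \<Rightarrow> (('k, 'a, 'b) history \<Rightarrow> 'a \<Rightarrow> real) \<Rightarrow>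
   ('k, 'a, 'b) history \<Rightarrow> real" where
  "inflow1 p P R I =
     (case I of (h, k') \<Rightarrow>
        if h = [] then pmf p k'
        else (case last h of (k, a, b) \<Rightarrow> pmf (P a b k) k' * R (butlast h, k) a))"

definition inflow2 ::
  "'l pmf \<Rightarrow> ('a \<Rightarrow> 'b \<Rightarrow> 'l \<Rightarrow> 'l pmf) \<Rightarrow> (('l, 'a, 'b) history \<Rightarrow> 'b \<Rightarrow> real) \<Rightarrow>
   ('l, 'a, 'b) history \<Rightarrow> real" where
  "inflow2 q Q S J =
     (case J of (h, l') \<Rightarrow>
        if h = [] then pmf q l'
        else (case last h of (l, a, b) \<Rightarrow> pmf (Q a b l) l' * S (butlast h, l) b))"

definition lp1_feasible ::
  "('k::finite \<Rightarrow> 'l::finite \<Rightarrow> 'a::finite \<Rightarrow> 'b::finite \<Rightarrow> real) \<Rightarrow>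
   ('a \<Rightarrow> 'b \<Rightarrow> 'k \<Rightarrow> 'k pmf) \<Rightarrow> ('a \<Rightarrow> 'b \<Rightarrow> 'l \<Rightarrow> 'l pmf) \<Rightarrow> real \<Rightarrow> nat \<Rightarrow> 'k pmf \<Rightarrow>
   (('k, 'a, 'b) history \<Rightarrow> 'a \<Rightarrow> real) \<times> (('l, 'a, 'b) history \<Rightarrow> real) \<Rightarrow> bool" where
  "lp1_feasible G P Q lam n p = (\<lambda>(R, U).
     (\<forall>h l b. length h < n \<longrightarrow>
        (\<Sum>I\<in>matching (h, l). \<Sum>a\<in>UNIV. R I a * lam ^ length h * G (snd I) l a b) +
        (\<Sum>l'\<in>UNIV. \<Sum>a\<in>UNIV. pmf (Q a b l) l' * U (h @ [(l, a, b)], l')) \<ge> U (h, l)) \<and>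
     (\<forall>h k. length h < n \<longrightarrow> (\<Sum>a\<in>UNIV. R (h, k) a) = inflow1 p P R (h, k)) \<and>
     (\<forall>h l. length h = n \<longrightarrow> U (h, l) = 0) \<and>
     (\<forall>h k a. length h < n \<longrightarrow> R (h, k) a \<ge> 0))"

definition lp1_objective ::
  "'l::finite pmf \<Rightarrow>
   (('k, 'a, 'b) history \<Rightarrow> 'a \<Rightarrow> real) \<times> (('l, 'a, 'b) history \<Rightarrow> real) \<Rightarrow> real" where
  "lp1_objective q = (\<lambda>(R, U). \<Sum>l\<in>UNIV. pmf q l * U ([], l))"

definition lp1_optimal where
  "lp1_optimal G P Q lam n p q R U \<longleftrightarrow>
     is_arg_max (lp1_objective q) (lp1_feasible G P Q lam n p) (R, U)"

definition lp2_feasible ::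
  "('k::finite \<Rightarrow> 'l::finite \<Rightarrow> 'a::finite \<Rightarrow> 'b::finite \<Rightarrow> real) \<Rightarrow>
   ('a \<Rightarrow> 'b \<Rightarrow> 'k \<Rightarrow> 'k pmf) \<Rightarrow> ('a \<Rightarrow> 'b \<Rightarrow> 'l \<Rightarrow> 'l pmf) \<Rightarrow> real \<Rightarrow> nat \<Rightarrow> 'l pmf \<Rightarrow>
   (('l, 'a, 'b) history \<Rightarrow> 'b \<Rightarrow> real) \<times> (('k, 'a, 'b) history \<Rightarrow> real) \<Rightarrow> bool" where
  "lp2_feasible G P Q lam n q = (\<lambda>(S, Z).
     (\<forall>h k a. length h < n \<longrightarrow>
        (\<Sum>J\<in>matching (h, k). \<Sum>b\<in>UNIV. S J b * lam ^ length h * G k (snd J) a b) +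
        (\<Sum>k'\<in>UNIV. \<Sum>b\<in>UNIV. pmf (P a b k) k' * Z (h @ [(k, a, b)], k')) \<le> Z (h, k)) \<and>
     (\<forall>h l. length h < n \<longrightarrow> (\<Sum>b\<in>UNIV. S (h, l) b) = inflow2 q Q S (h, l)) \<and>
     (\<forall>h k. length h = n \<longrightarrow> Z (h, k) = 0) \<and>
     (\<forall>h l b. length h < n \<longrightarrow> S (h, l) b \<ge> 0))"

definition lp2_objective ::
  "'k::finite pmf \<Rightarrow>
   (('l, 'a, 'b) history \<Rightarrow> 'b \<Rightarrow> real) \<times> (('k, 'a, 'b) history \<Rightarrow> real) \<Rightarrow> real" where
  "lp2_objective p = (\<lambda>(S, Z). \<Sum>k\<in>UNIV. pmf p k * Z ([], k))"

definition lp2_optimal where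
  "lp2_optimal G P Q lam n p q S Z \<longleftrightarrow>
     is_arg_min (lp2_objective p) (lp2_feasible G P Q lam n q) (S, Z)"

(* No condition is imposed at histories of vanishing inflow. *)
definition induced1 ::
  "('a \<Rightarrow> 'b \<Rightarrow> 'k \<Rightarrow> 'k pmf) \<Rightarrow> nat \<Rightarrow> 'k pmf \<Rightarrow> (('k, 'a, 'b) history \<Rightarrow> 'a \<Rightarrow> real) \<Rightarrow>
   ('k, 'a, 'b) strategy1 \<Rightarrow> bool" where
  "induced1 P n p R \<sigma> \<longleftrightarrow>
     (\<forall>h k. length h < n \<and> inflow1 p P R (h, k) \<noteq> 0 \<longrightarrow>
        (\<forall>a. pmf (\<sigma> (h, k)) a = R (h, k) a / inflow1 p P R (h, k)))"

definition induced2 ::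
  "('a \<Rightarrow> 'b \<Rightarrow> 'l \<Rightarrow> 'l pmf) \<Rightarrow> nat \<Rightarrow> 'l pmf \<Rightarrow> (('l, 'a, 'b) history \<Rightarrow> 'b \<Rightarrow> real) \<Rightarrow>
   ('l, 'a, 'b) strategy2 \<Rightarrow> bool" where
  "induced2 Q n q S \<tau> \<longleftrightarrow>
     (\<forall>h l. length h < n \<and> inflow2 q Q S (h, l) \<noteq> 0 \<longrightarrow>
        (\<forall>b. pmf (\<tau> (h, l)) b = S (h, l) b / inflow2 q Q S (h, l)))"

end

theory Submission
  imports Defs
begin

text \<open>
  A behaviour strategy corresponds to its realization plan \<open>R\<close>, the probability of the owner's
  choices and states along a history; plans are the solutions of the flow constraints, and the
  payoff is bilinear in the plans of the two players.  Telescoping along the play writes the payoff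
  as \<open>\<Sum>l. q l * U ([], l)\<close> plus the slacks of the Bellman constraints weighted with the plan of
  player 2, for every \<open>U\<close> that vanishes after stage \<open>n\<close>.  So a feasible \<open>(R, U)\<close> bounds from below
  what \<open>R\<close> guarantees, for every initial law of player 2 at once, and the backward induction
  solution \<open>U\<close> attains the bound.  Hence it gives the vector payoff, and any optimal \<open>U\<close> agrees
  with it on the support of \<open>q\<close>.

  Plans form a compact set closed under mixing, so a saddle point exists by a minimax theorem.  The
  program of player 2 is that of player 1 in the game with the players exchanged and payoff \<open>- G\<close>.
\<close>

section \<open>A minimax theorem for compact spaces\<close>

text \<open>The ratio \<open>t / (1 - t)\<close> of the two weights is bounded above by points with
  \<open>g x\<close> nonnegative and below by points with \<open>h x\<close> nonnegative. When both
  kinds exist, compactness attains both extremal bounds, and mixing the two extremal points shows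
  that the lower bound is strictly smaller, which leaves room for a ratio.\<close>

lemma two_point_mix:
  fixes g h :: "'x::topological_space \<Rightarrow> real"
  assumes X: "compact X"
    and cont: "continuous_on UNIV g" "continuous_on UNIV h"
    and mix: "\<And>x y t. x \<in> X \<Longrightarrow> y \<in> X \<Longrightarrow> 0 \<le> t \<Longrightarrow> t \<le> 1 \<Longrightarrow>
      \<exists>z\<in>X. t * g x + (1 - t) * g y \<le> g z \<and> t * h x + (1 - t) * h y \<le> h z"
    and neg: "\<And>x. x \<in> X \<Longrightarrow> g x < 0 \<or> h x < 0"
  shows "\<exists>t. 0 \<le> t \<and> t \<le> 1 \<and> (\<forall>x\<in>X. t * g x + (1 - t) * h x < 0)"
proof -
  define A where "A = X \<inter> {x. 0 \<le> g x}"
  define B where "B = X \<inter> {x. 0 \<le> h x}"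
  have cA: "compact A" and cB: "compact B"
    unfolding A_def B_def by (intro compact_Int_closed closed_Collect_le X cont continuous_intros)+
  have A: "0 \<le> g x" "h x < 0" if "x \<in> A" for x
    using that neg[of x] by (auto simp: A_def)
  have B: "0 \<le> h x" "g x < 0" if "x \<in> B" for x
    using that neg[of x] by (auto simp: B_def)
  consider "A = {}" | "B = {}" | "A \<noteq> {}" "B \<noteq> {}" by blast
  then show ?thesis
  proof cases
    case 1
    then have "\<forall>x\<in>X. 1 * g x + (1 - 1) * h x < 0" by (force simp: A_def)
    then show ?thesis by (intro exI[of _ 1]) simp
  next
    case 2
    then have "\<forall>x\<in>X. 0 * g x + (1 - 0) * h x < 0" by (force simp: B_def)
    then show ?thesis by (intro exI[of _ 0]) simp
  next
    case 3
    have "continuous_on A (\<lambda>x. g x / - h x)"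
      using A cont by (intro continuous_intros) (auto intro: continuous_on_subset dest!: A(2))
    then obtain x1 where x1: "x1 \<in> A" "\<And>x. x \<in> A \<Longrightarrow> g x / - h x \<le> g x1 / - h x1"
      using continuous_attains_sup[OF cA 3(1)] by blast
    have "continuous_on B (\<lambda>x. h x / - g x)"
      using B cont by (intro continuous_intros) (auto intro: continuous_on_subset dest!: B(2))
    then obtain x2 where x2: "x2 \<in> B" "\<And>x. x \<in> B \<Longrightarrow> h x / - g x \<le> h x2 / - g x2"
      using continuous_attains_sup[OF cB 3(2)] by blast
    define s1 where "s1 = g x1 / - h x1"
    define s2 where "s2 = h x2 / - g x2"
    note sg = A[OF x1(1)] B[OF x2(1)]
    have s: "0 \<le> s1" "0 \<le> s2"
      using sg by (auto simp: s1_def s2_def divide_nonneg_nonpos)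
    have lt1: "s1 * s2 < 1"
    proof (rule ccontr)
      assume "\<not> s1 * s2 < 1"
      then have ge: "g x1 * h x2 \<ge> h x1 * g x2"
        using sg mult_neg_neg[of "h x1" "g x2"] by (simp add: s1_def s2_def field_simps)
      define d where "d = g x1 - g x2"
      have d: "d > 0" using sg by (simp add: d_def)
      \<comment> \<open>With this weight the mixture of \<open>g x1\<close> and \<open>g x2\<close>
        is zero, while \<open>ge\<close> makes the mixture of \<open>h x1\<close> and
        \<open>h x2\<close> nonnegative. The dominating point \<open>z\<close> then contradicts
        \<open>neg\<close>.\<close>
      define t where "t = - g x2 / d"
      have t: "0 \<le> t" "t \<le> 1" using sg d by (auto simp: t_def d_def field_simps)
      have t1: "1 - t = g x1 / d" using d by (simp add: t_def d_def field_simps)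
      obtain z where z: "z \<in> X" "t * g x1 + (1 - t) * g x2 \<le> g z"
          "t * h x1 + (1 - t) * h x2 \<le> h z"
        using mix[of x1 x2 t] x1(1) x2(1) t by (auto simp: A_def B_def)
      have "t * g x1 + (1 - t) * g x2 = 0" using d by (simp add: t1) (simp add: t_def)
      moreover have "t * h x1 + (1 - t) * h x2 = (g x1 * h x2 - h x1 * g x2) / d"
        by (simp add: t1) (simp add: t_def diff_divide_distrib)
      then have "t * h x1 + (1 - t) * h x2 \<ge> 0" using ge d by simp
      ultimately show False using z neg[of z] by linarith
    qed
    \<comment> \<open>Any \<open>r\<close> strictly between \<open>s2\<close> and
      \<open>1 / s1\<close> serves; for \<open>s1 = 0\<close> there is no upper bound.\<close>
    obtain r where r: "s2 < r" "r * s1 < 1" "0 < r"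
    proof (cases "s1 = 0")
      case True
      then show ?thesis using that[of "s2 + 1"] s by simp
    next
      case False
      then have "s2 < 1 / s1" using lt1 s by (simp add: field_simps)
      then obtain r where "s2 < r" "r < 1 / s1" using dense by blast
      then show ?thesis using that[of r] s False by (simp add: field_simps)
    qed
    \<comment> \<open>The weight ratio r must exceed h/(-g) on B and stay below (-h)/g on A.\<close>
    have "r * g x + h x < 0" if x: "x \<in> X" for x
    proof (cases "x \<in> A")
      case True
      have "g x / - h x * r \<le> s1 * r"
        using x1(2)[OF True] r by (intro mult_right_mono) (auto simp: s1_def)
      also have "\<dots> < 1" using r by (simp add: mult.commute)
      finally show ?thesis using A[OF True] by (simp add: field_simps)
    next
      case False
      then have g: "g x < 0" using x by (auto simp: A_def)
      show ?thesis
      proof (cases "x \<in> B")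
        case True
        then have "h x / - g x < r" using x2(2)[OF True] r by (simp add: s2_def)
        then show ?thesis using g by (simp add: field_simps)
      next
        case False
        then have "h x < 0" using x by (auto simp: B_def)
        moreover have "r * g x < 0" using g r by (simp add: mult_pos_neg)
        ultimately show ?thesis by linarith
      qed
    qed
    \<comment> \<open>The weights \<open>r\<close> and 1 are normalized to sum to 1, which gives
      \<open>t = r / (r + 1)\<close>.\<close>
    moreover have "r / (r + 1) * g x + (1 - r / (r + 1)) * h x = (r * g x + h x) / (r + 1)" for x
    proof -
      have "1 - r / (r + 1) = 1 / (r + 1)" using r by (simp add: field_simps)
      then show ?thesis by (simp add: add_divide_distrib)
    qed
    ultimately have "\<forall>x\<in>X. r / (r + 1) * g x + (1 - r / (r + 1)) * h x < 0"
      using r by (simp add: divide_neg_pos)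
    then show ?thesis using r by (intro exI[of _ "r / (r + 1)"]) auto
  qed
qed

text \<open>
  The hypotheses on mixtures are Fan's concavelike and convexlike conditions.  The induction applies
  the hypothesis to the part of \<open>X\<close> on which one of the points fails and mixes the result with it.
\<close>
lemma finite_minimax:
  fixes f :: "'x::topological_space \<Rightarrow> 'y \<Rightarrow> real"
  assumes "finite F" "F \<subseteq> Y" "Y \<noteq> {}" "compact X"
    and "\<And>y. continuous_on UNIV (\<lambda>x. f x y)"
    and "\<And>x x' t. x \<in> X \<Longrightarrow> x' \<in> X \<Longrightarrow> 0 \<le> t \<Longrightarrow> t \<le> 1 \<Longrightarrow>
      \<exists>z\<in>X. \<forall>y\<in>Y. t * f x y + (1 - t) * f x' y \<le> f z y"
    and "\<And>y y' t. y \<in> Y \<Longrightarrow> y' \<in> Y \<Longrightarrow> 0 \<le> t \<Longrightarrow> t \<le> 1 \<Longrightarrow>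
      \<exists>z\<in>Y. \<forall>x\<in>X. f x z \<le> t * f x y + (1 - t) * f x y'"
    and "\<And>x. x \<in> X \<Longrightarrow> \<exists>y\<in>F. f x y < c"
  shows "\<exists>y\<in>Y. \<forall>x\<in>X. f x y < c"
  using assms
proof (induction F arbitrary: X)
  case empty
  have "X = {}" using empty.prems(7) by blast
  then show ?case using \<open>Y \<noteq> {}\<close> by blast
next
  case (insert y1 F)
  note convX = insert.prems(5) and convY = insert.prems(6)
  define X' where "X' = X \<inter> {x. c \<le> f x y1}"
  have y1: "y1 \<in> Y" using insert.prems by simp
  have "\<exists>y\<in>Y. \<forall>x\<in>X'. f x y < c"
  proof (rule insert.IH)
    show "compact X'" unfolding X'_def
      by (intro compact_Int_closed closed_Collect_le continuous_intros insert.prems)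
  next
    fix x x' and t :: real assume a: "x \<in> X'" "x' \<in> X'" "0 \<le> t" "t \<le> 1"
    then obtain z where z: "z \<in> X" "\<forall>y\<in>Y. t * f x y + (1 - t) * f x' y \<le> f z y"
      using convX[of x x' t] by (auto simp: X'_def)
    have "c = t * c + (1 - t) * c" by (simp add: algebra_simps)
    also have "\<dots> \<le> t * f x y1 + (1 - t) * f x' y1"
      using a by (intro add_mono mult_left_mono) (auto simp: X'_def)
    also have "\<dots> \<le> f z y1" using z y1 by blast
    finally show "\<exists>z\<in>X'. \<forall>y\<in>Y. t * f x y + (1 - t) * f x' y \<le> f z y"
      using z by (auto simp: X'_def)
  next
    fix y y' and t :: real assume "y \<in> Y" "y' \<in> Y" "0 \<le> t" "t \<le> 1"
    then show "\<exists>z\<in>Y. \<forall>x\<in>X'. f x z \<le> t * f x y + (1 - t) * f x y'"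
      using convY[of y y' t] by (auto simp: X'_def)
  next
    fix x assume "x \<in> X'"
    then show "\<exists>y\<in>F. f x y < c" using insert.prems(7)[of x] by (auto simp: X'_def)
  qed (use insert.prems in auto)
  then obtain y2 where y2: "y2 \<in> Y" "\<forall>x\<in>X'. f x y2 < c" by blast
  \<comment> \<open>Outside \<open>X'\<close> the point \<open>y1\<close> keeps \<open>f\<close>
    below \<open>c\<close>, on \<open>X'\<close> the point \<open>y2\<close> does, so one of the two
    differences is negative everywhere on \<open>X\<close>.\<close>
  have "\<exists>t. 0 \<le> t \<and> t \<le> 1 \<and> (\<forall>x\<in>X. t * (f x y1 - c) + (1 - t) * (f x y2 - c) < 0)"
  proof (rule two_point_mix)
    fix x x' and t :: real assume a: "x \<in> X" "x' \<in> X" "0 \<le> t" "t \<le> 1"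
    then obtain z where z: "z \<in> X" "\<forall>y\<in>Y. t * f x y + (1 - t) * f x' y \<le> f z y"
      using convX[of x x' t] by auto
    then have "t * f x y1 + (1 - t) * f x' y1 \<le> f z y1" "t * f x y2 + (1 - t) * f x' y2 \<le> f z y2"
      using y1 y2(1) by blast+
    then show "\<exists>z\<in>X. t * (f x y1 - c) + (1 - t) * (f x' y1 - c) \<le> f z y1 - c \<and>
        t * (f x y2 - c) + (1 - t) * (f x' y2 - c) \<le> f z y2 - c"
      using z(1) by (intro bexI[of _ z]) (auto simp: algebra_simps)
  next
    fix x assume "x \<in> X"
    then show "f x y1 - c < 0 \<or> f x y2 - c < 0" using y2 by (auto simp: X'_def)
  qed (intro insert.prems continuous_intros)+
  then obtain t where t: "0 \<le> t" "t \<le> 1"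
    "\<And>x. x \<in> X \<Longrightarrow> t * (f x y1 - c) + (1 - t) * (f x y2 - c) < 0" by blast
  obtain y where "y \<in> Y" "\<forall>x\<in>X. f x y \<le> t * f x y1 + (1 - t) * f x y2"
    using convY[OF y1 y2(1) t(1,2)] by blast
  moreover have "t * f x y1 + (1 - t) * f x y2 < c" if "x \<in> X" for x
    using t(3)[OF that] by (simp add: algebra_simps)
  ultimately show ?case by force
qed

text \<open>Let \<open>v\<close> be the supremum over \<open>X\<close> of the infima over
  \<open>Y\<close>. For each \<open>c\<close> above \<open>v\<close>, compactness of
  \<open>X\<close> reduces the search for a \<open>y\<close> with \<open>f x y < c\<close> on all of
  \<open>X\<close> to finitely many points, where \<open>finite_minimax\<close> applies. Compactness
  of \<open>Y\<close> then yields one \<open>y0\<close> good for all such \<open>c\<close>,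
  compactness of \<open>X\<close> one \<open>x0\<close> good for all thresholds below
  \<open>v\<close>, and \<open>v\<close> separates the two sides.\<close>

theorem minimax_saddle_point:
  fixes f :: "'x::topological_space \<Rightarrow> 'y::topological_space \<Rightarrow> real"
  assumes X: "compact X" "X \<noteq> {}" and Y: "compact Y" "Y \<noteq> {}"
    and cont1: "\<And>y. continuous_on UNIV (\<lambda>x. f x y)"
    and cont2: "\<And>x. continuous_on UNIV (\<lambda>y. f x y)"
    and concave: "\<And>x x' t. x \<in> X \<Longrightarrow> x' \<in> X \<Longrightarrow> 0 \<le> t \<Longrightarrow> t \<le> 1 \<Longrightarrow>
      \<exists>z\<in>X. \<forall>y\<in>Y. t * f x y + (1 - t) * f x' y \<le> f z y"
    and convex: "\<And>y y' t. y \<in> Y \<Longrightarrow> y' \<in> Y \<Longrightarrow> 0 \<le> t \<Longrightarrow> t \<le> 1 \<Longrightarrow>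
      \<exists>z\<in>Y. \<forall>x\<in>X. f x z \<le> t * f x y + (1 - t) * f x y'"
  shows "\<exists>x0\<in>X. \<exists>y0\<in>Y. \<forall>x\<in>X. \<forall>y\<in>Y. f x y0 \<le> f x0 y"
proof -
  define m where "m x = (INF y\<in>Y. f x y)" for x
  have "\<exists>y\<in>Y. \<forall>y'\<in>Y. f x y \<le> f x y'" for x
    using continuous_attains_inf[OF Y] cont2 continuous_on_subset by blast
  then have bddY: "bdd_below (f x ` Y)" for x
    by (fastforce simp: bdd_below_def)
  have m_le: "m x \<le> f x y" if "y \<in> Y" for x y
    unfolding m_def using bddY that by (rule cINF_lower)
  obtain yy where yy: "yy \<in> Y" using Y by blast
  obtain xm where xm: "xm \<in> X" "\<forall>x\<in>X. f x yy \<le> f xm yy"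
    using continuous_attains_sup[OF X, of "\<lambda>x. f x yy"] cont1 continuous_on_subset by blast
  have bddX: "bdd_above (m ` X)"
    unfolding bdd_above_def using m_le[OF yy] xm by (auto intro!: exI[of _ "f xm yy"] dest: order_trans)
  define v where "v = (SUP x\<in>X. m x)"
  have m_v: "m x \<le> v" if "x \<in> X" for x
    unfolding v_def using that bddX by (rule cSUP_upper)
  have above: "\<exists>y\<in>Y. \<forall>x\<in>X. f x y < c" if c: "v < c" for c
  proof -
    \<comment> \<open>A common point would have infimum at least \<open>c\<close>, above the
      supremum \<open>v\<close>.\<close>
    have "X \<inter> (\<Inter>y\<in>Y. {x. c \<le> f x y}) = {}"
    proof (rule ccontr)
      assume "X \<inter> (\<Inter>y\<in>Y. {x. c \<le> f x y}) \<noteq> {}"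
      then obtain x where "x \<in> X" "\<forall>y\<in>Y. c \<le> f x y" by auto
      then have "c \<le> m x" unfolding m_def using Y by (intro cINF_greatest) auto
      then show False using m_v[OF \<open>x \<in> X\<close>] c by simp
    qed
    moreover have "closed {x. c \<le> f x y}" for y
      by (intro closed_Collect_le cont1 continuous_intros)
    ultimately obtain F where F: "finite F" "F \<subseteq> Y" "X \<inter> (\<Inter>y\<in>F. {x. c \<le> f x y}) = {}"
      using compact_imp_fip_image[OF X(1), of Y "\<lambda>y. {x. c \<le> f x y}"] by blast
    show ?thesis
    proof (rule finite_minimax[OF F(1,2) Y(2) X(1) cont1 concave convex])
      show "\<exists>y\<in>F. f x y < c" if "x \<in> X" for x using F(3) that by force
    qed
  qed
  have "Y \<inter> (\<Inter>i\<in>X \<times> {v<..}. {y. f (fst i) y \<le> snd i}) \<noteq> {}"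
  proof (rule compact_imp_fip_image[OF Y(1)])
    show "closed {y. f (fst i) y \<le> snd i}" for i
      by (intro closed_Collect_le cont2 continuous_intros)
    fix I assume I: "finite I" "I \<subseteq> X \<times> {v<..}"
    \<comment> \<open>Finitely many thresholds above \<open>v\<close> are replaced by their minimum,
      which still exceeds \<open>v\<close>; the entry \<open>v + 1\<close> covers the case of empty
      \<open>I\<close>.\<close>
    define c where "c = Min (insert (v + 1) (snd ` I))"
    have c: "v < c" "\<And>i. i \<in> I \<Longrightarrow> c \<le> snd i" using I by (auto simp: c_def)
    then obtain y where "y \<in> Y" "\<forall>x\<in>X. f x y < c" using above by blast
    then show "Y \<inter> (\<Inter>i\<in>I. {y. f (fst i) y \<le> snd i}) \<noteq> {}" using c(2) I(2) by force
  qed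
  then obtain y0 where y0: "y0 \<in> Y" "\<And>x c. x \<in> X \<Longrightarrow> v < c \<Longrightarrow> f x y0 \<le> c" by force
  then have y0': "f x y0 \<le> v" if "x \<in> X" for x
    using that by (meson dense_ge)
  have "X \<inter> (\<Inter>i\<in>Y \<times> {..<v}. {x. snd i \<le> f x (fst i)}) \<noteq> {}"
  proof (rule compact_imp_fip_image[OF X(1)])
    show "closed {x. snd i \<le> f x (fst i)}" for i
      by (intro closed_Collect_le cont1 continuous_intros)
    fix I assume I: "finite I" "I \<subseteq> Y \<times> {..<v}"
    define c where "c = Max (insert (v - 1) (snd ` I))"
    have c: "c < v" "\<And>i. i \<in> I \<Longrightarrow> snd i \<le> c" using I by (auto simp: c_def)
    then obtain x where x: "x \<in> X" "c < m x"
      using less_cSUP_iff[OF X(2) bddX] by (auto simp: v_def)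
    have "snd i \<le> f x (fst i)" if "i \<in> I" for i
    proof -
      have "fst i \<in> Y" using that I(2) by auto
      then show ?thesis using c(2)[OF that] x(2) m_le[of "fst i" x] by linarith
    qed
    then show "X \<inter> (\<Inter>i\<in>I. {x. snd i \<le> f x (fst i)}) \<noteq> {}"
      using x(1) by blast
  qed
  then obtain x0 where x0: "x0 \<in> X" "\<And>y c. y \<in> Y \<Longrightarrow> c < v \<Longrightarrow> c \<le> f x0 y" by force
  then have "v \<le> f x0 y" if "y \<in> Y" for y
    using that by (meson dense_le)
  then show ?thesis using x0(1) y0(1) y0' by (meson order_trans)
qed

section \<open>Realization plans\<close>

text \<open>The list of past stages is reversed, latest stage first.\<close>
primrec rev_reach :: "'k pmf \<Rightarrow> ('a \<Rightarrow> 'b \<Rightarrow> 'k \<Rightarrow> 'k pmf) \<Rightarrow> ('k, 'a, 'b) strategy1 \<Rightarrow>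
    ('k \<times> 'a \<times> 'b) list \<Rightarrow> 'k \<Rightarrow> real" where
  "rev_reach p P \<sigma> [] k' = pmf p k'"
| "rev_reach p P \<sigma> (x # r) k' = (case x of (k, a, b) \<Rightarrow>
     pmf (P a b k) k' * (rev_reach p P \<sigma> r k * pmf (\<sigma> (rev r, k)) a))"

definition reach where
  "reach p P \<sigma> I = rev_reach p P \<sigma> (rev (fst I)) (snd I)"

definition plan where
  "plan p P \<sigma> I a = reach p P \<sigma> I * pmf (\<sigma> I) a"

definition is_plan :: "'k pmf \<Rightarrow> ('a::finite \<Rightarrow> 'b \<Rightarrow> 'k \<Rightarrow> 'k pmf) \<Rightarrow> nat \<Rightarrow>
    (('k, 'a, 'b) history \<Rightarrow> 'a \<Rightarrow> real) \<Rightarrow> bool" where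
  "is_plan p P n R \<longleftrightarrow> (\<forall>I. length (fst I) < n \<longrightarrow>
     (\<Sum>a\<in>UNIV. R I a) = inflow1 p P R I \<and> (\<forall>a. 0 \<le> R I a))"

lemma reach_Nil [simp]: "reach p P \<sigma> ([], k) = pmf p k"
  by (simp add: reach_def)

text \<open>Together with the value at the empty past, this recursion on the latest stage in
  chronological order replaces the reversed recursion from here on.\<close>

lemma reach_snoc [simp]:
  "reach p P \<sigma> (h @ [(k, a, b)], k') = pmf (P a b k) k' * plan p P \<sigma> (h, k) a"
  by (simp add: reach_def plan_def)

lemma inflow1_Nil [simp]: "inflow1 p P R ([], k) = pmf p k"
  and inflow1_snoc [simp]: "inflow1 p P R (h @ [(k, a, b)], k') = pmf (P a b k) k' * R (h, k) a"
  by (simp_all add: inflow1_def)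

lemma snoc_cases [case_names Nil snoc]:
  obtains "h = []" | g k a b where "h = g @ [(k, a, b)]"
  by (cases h rule: rev_cases) auto

text \<open>Hence, for the plan of a strategy, the denominator in the formula that recovers the
  strategy is its reach.\<close>

lemma inflow1_plan: "inflow1 p P (plan p P \<sigma>) I = reach p P \<sigma> I"
proof (cases I)
  case (Pair h k)
  then show ?thesis by (cases h rule: snoc_cases) simp_all
qed

lemma reach_nonneg: "0 \<le> reach p P \<sigma> (h, k)"
proof (induction h arbitrary: k rule: rev_induct)
  case (snoc x h)
  then show ?case by (cases x) (simp add: plan_def)
qed simp

lemma plan_nonneg: "0 \<le> plan p P \<sigma> I a"
  using reach_nonneg[of p P \<sigma> "fst I" "snd I"] by (simp add: plan_def)

lemma sum_pmf_UNIV: "(\<Sum>x\<in>UNIV. pmf p x) = 1" for p :: "'x::finite pmf"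
  by (rule sum_pmf_eq_1) auto

lemma sum_plan: "(\<Sum>a\<in>UNIV. plan p P \<sigma> I a) = reach p P \<sigma> I"
  for \<sigma> :: "('k, 'a::finite, 'b) strategy1"
  by (simp add: plan_def sum_pmf_UNIV flip: sum_distrib_left)

lemma is_plan_plan: "is_plan p P n (plan p P \<sigma>)"
  by (simp add: is_plan_def sum_plan inflow1_plan plan_nonneg)

text \<open>The inflow at a history depends only on \<open>R\<close> at the predecessor, so by
  induction it equals the reach. If it is nonzero, multiplying \<open>\<sigma>\<close> by it gives
  back \<open>R\<close>. If it is zero, the nonnegative entries of \<open>R\<close> sum to zero and
  vanish, whatever \<open>\<sigma>\<close> does there.\<close>

lemma plan_unique:
  assumes R: "is_plan p P n R" and \<sigma>: "induced1 P n p R \<sigma>" and "length h < n"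
  shows "R (h, k) a = plan p P \<sigma> (h, k) a"
  using assms(3)
proof (induction h arbitrary: k a rule: length_induct)
  case (1 h)
  have inflow: "inflow1 p P R (h, k) = reach p P \<sigma> (h, k)"
  proof (cases h rule: snoc_cases)
    case (snoc g k' a b)
    then have "R (g, k') a = plan p P \<sigma> (g, k') a"
      using 1(1)[rule_format, of g k' a] 1(2) by simp
    then show ?thesis by (simp add: snoc)
  qed simp
  have flow: "(\<Sum>a\<in>UNIV. R (h, k) a) = inflow1 p P R (h, k)" "\<And>a. 0 \<le> R (h, k) a"
    using R 1(2) by (auto simp: is_plan_def)
  show ?case
  proof (cases "reach p P \<sigma> (h, k) = 0")
    case True
    then have "R (h, k) a = 0"
      using flow inflow by (simp add: sum_nonneg_eq_0_iff)
    with True show ?thesis by (simp add: plan_def)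
  next
    case False
    then show ?thesis using \<sigma> 1(2) by (simp add: induced1_def inflow plan_def)
  qed
qed

lemma pmf_of_weights:
  fixes w :: "'x::finite \<Rightarrow> real"
  assumes "\<And>x. 0 \<le> w x" "(\<Sum>x\<in>UNIV. w x) = 1"
  shows "\<exists>\<mu>. \<forall>x. pmf \<mu> x = w x"
proof -
  have "(\<integral>\<^sup>+x. ennreal (w x) \<partial>count_space UNIV) = 1"
    using assms by (simp add: nn_integral_count_space_finite)
  then show ?thesis
    using assms(1) by (intro exI[of _ "embed_pmf w"] allI pmf_embed_pmf) auto
qed

text \<open>Where the inflow is nonzero it is a positive sum of nonnegative entries, so dividing
  \<open>R\<close> by it gives probability weights; elsewhere any distribution will do.\<close>

lemma induced1_exists:
  assumes R: "is_plan p P n R"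
  shows "\<exists>\<sigma>. induced1 P n p R \<sigma>"
proof -
  have "\<exists>\<mu>. length (fst I) < n \<and> inflow1 p P R I \<noteq> 0 \<longrightarrow>
      (\<forall>a. pmf \<mu> a = R I a / inflow1 p P R I)" for I
  proof (cases "length (fst I) < n \<and> inflow1 p P R I \<noteq> 0")
    case True
    then have flow: "(\<Sum>a\<in>UNIV. R I a) = inflow1 p P R I" "\<And>a. 0 \<le> R I a"
      using R unfolding is_plan_def by blast+
    then have "0 \<le> inflow1 p P R I" by (metis sum_nonneg)
    moreover have "(\<Sum>a\<in>UNIV. R I a / inflow1 p P R I) = 1"
      using flow(1) True by (simp flip: sum_divide_distrib)
    ultimately have "\<exists>\<mu>. \<forall>a. pmf \<mu> a = R I a / inflow1 p P R I"
      using flow(2) by (intro pmf_of_weights) auto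
    then show ?thesis by blast
  qed auto
  then obtain \<sigma> where "\<And>I. length (fst I) < n \<and> inflow1 p P R I \<noteq> 0 \<longrightarrow>
      (\<forall>a. pmf (\<sigma> I) a = R I a / inflow1 p P R I)"
    by metis
  then show ?thesis by (intro exI[of _ \<sigma>]) (simp add: induced1_def)
qed

section \<open>Relabelling histories for the mirrored game\<close>

definition swap_actions :: "('s \<times> 'a \<times> 'b) list \<Rightarrow> ('s \<times> 'b \<times> 'a) list" where
  "swap_actions = map (\<lambda>(s, a, b). (s, b, a))"

definition swap_history :: "('s, 'a, 'b) history \<Rightarrow> ('s, 'b, 'a) history" where
  "swap_history = map_prod swap_actions id"

lemma swap_actions_swap_actions [simp]: "swap_actions (swap_actions h) = h"
  by (induction h) (auto simp: swap_actions_def)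

lemma length_swap_actions [simp]: "length (swap_actions h) = length h"
  by (simp add: swap_actions_def)

lemma swap_actions_simps [simp]:
  "swap_actions [] = []" "swap_actions ((s, a, b) # g) = (s, b, a) # swap_actions g"
  "swap_actions (h @ g) = swap_actions h @ swap_actions g"
  by (simp_all add: swap_actions_def)

lemma swap_history_pair [simp]: "swap_history (h, s) = (swap_actions h, s)"
  by (simp add: swap_history_def)

lemma swap_history_swap_history [simp]: "swap_history (swap_history I) = I"
  by (cases I) simp

lemma fst_swap_history [simp]: "fst (swap_history I) = swap_actions (fst I)"
  and snd_swap_history [simp]: "snd (swap_history I) = snd I"
  by (cases I; simp)+

text \<open>Player 2 is treated as player 1 of the mirrored game, whose histories list his action first.\<close>
abbreviation reach2 where
  "reach2 q Q \<tau> J \<equiv> reach q (\<lambda>b a. Q a b) (\<lambda>J. \<tau> (swap_history J)) (swap_history J)"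

abbreviation plan2 where
  "plan2 q Q \<tau> J \<equiv> plan q (\<lambda>b a. Q a b) (\<lambda>J. \<tau> (swap_history J)) (swap_history J)"

lemma plan2_eq: "plan2 q Q \<tau> J b = reach2 q Q \<tau> J * pmf (\<tau> J) b"
  by (simp add: plan_def)


section \<open>The payoff in terms of plans\<close>

lemma sum_lists_Suc:
  fixes F :: "'x::finite list \<Rightarrow> real"
  shows "(\<Sum>h | length h = Suc t. F h) = (\<Sum>h | length h = t. \<Sum>x\<in>UNIV. F (h @ [x]))"
proof -
  have "(\<Sum>h | length h = Suc t. F h) = (\<Sum>(h, x)\<in>{h. length h = t} \<times> UNIV. F (h @ [x]))"
  proof (rule sum.reindex_bij_witness[where i = "\<lambda>(h, x). h @ [x]" and j = "\<lambda>h. (butlast h, last h)"])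
    fix h :: "'x list" assume h: "h \<in> {h. length h = Suc t}"
    then have "h \<noteq> []" by force
    then show "(case (butlast h, last h) of (h, x) \<Rightarrow> h @ [x]) = h"
      "(case (butlast h, last h) of (h, x) \<Rightarrow> F (h @ [x])) = F h" by simp_all
    show "(butlast h, last h) \<in> {h. length h = t} \<times> UNIV" using h by simp
  qed (simp_all add: case_prod_unfold mem_Times_iff)
  then show ?thesis by (simp add: sum.cartesian_product)
qed

lemma finite_lists_length: "finite {h :: 'x::finite list. length h = t}"
  using finite_lists_length_eq[of "UNIV :: 'x set" t] by simp

lemma expectation_bind:
  fixes h :: "'y \<Rightarrow> real"
  assumes "finite (set_pmf p)" "\<And>x. x \<in> set_pmf p \<Longrightarrow> finite (set_pmf (f x))"
  shows "measure_pmf.expectation (p \<bind> f) h =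
    measure_pmf.expectation p (\<lambda>x. measure_pmf.expectation (f x) h)"
  using assms by (simp add: pmf_expectation_bind[of "set_pmf p"] integral_measure_pmf[of "set_pmf p"])

lemma expectation_finite: "measure_pmf.expectation p (f :: 'x \<Rightarrow> real) = (\<Sum>x\<in>UNIV. pmf p x * f x)"
  for p :: "'x::finite pmf"
  by (simp add: integral_measure_pmf[of UNIV])

lemma expectation_bind_finite:
  fixes h :: "'y \<Rightarrow> real" and p :: "'x::finite pmf"
  assumes "\<And>x. finite (set_pmf (f x))"
  shows "measure_pmf.expectation (p \<bind> f) h = (\<Sum>x\<in>UNIV. pmf p x * measure_pmf.expectation (f x) h)"
  using assms by (simp add: expectation_bind expectation_finite)

lemma finite_set_pmf_play:
  fixes P :: "'a::finite \<Rightarrow> 'b::finite \<Rightarrow> 'k::finite \<Rightarrow> 'k pmf" and q :: "'l::finite pmf"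
  shows "finite (set_pmf (play P Q p q \<sigma> \<tau> t))"
  by (induction t) auto

lemma sum_UNIV_prod:
  fixes F :: "'x::finite \<times> 'y::finite \<Rightarrow> real"
  shows "(\<Sum>z\<in>UNIV. F z) = (\<Sum>x\<in>UNIV. \<Sum>y\<in>UNIV. F (x, y))"
  by (simp add: sum.cartesian_product)

text \<open>Given the actions, the two state processes move independently, so the probability of a
  joint history factors into the reaches of its private views. The integrand \<open>F\<close> is
  arbitrary in the induction because each step absorbs one stage into it.\<close>

lemma expectation_play:
  fixes P :: "'a::finite \<Rightarrow> 'b::finite \<Rightarrow> 'k::finite \<Rightarrow> 'k pmf" and Q :: "'a \<Rightarrow> 'b \<Rightarrow> 'l::finite \<Rightarrow> 'l pmf"
    and F :: "('k \<times> 'l \<times> 'a \<times> 'b) list \<times> 'k \<times> 'l \<Rightarrow> real"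
  shows "measure_pmf.expectation (play P Q p q \<sigma> \<tau> t) F =
    (\<Sum>h | length h = t. \<Sum>k\<in>UNIV. \<Sum>l\<in>UNIV.
      reach p P \<sigma> (view1 h, k) * reach2 q Q \<tau> (view2 h, l) * F (h, k, l))"
proof (induction t arbitrary: F)
  case 0
  have "{h :: ('k \<times> 'l \<times> 'a \<times> 'b) list. h = []} = {[]}" by auto
  then show ?case
    by (simp add: expectation_bind_finite sum_distrib_left mult.assoc view1_def view2_def)
next
  case (Suc t)
  let ?step = "\<lambda>(h, k, l). \<Sum>a\<in>UNIV. pmf (\<sigma> (view1 h, k)) a * (\<Sum>b\<in>UNIV. pmf (\<tau> (view2 h, l)) b *
      (\<Sum>k'\<in>UNIV. pmf (P a b k) k' * (\<Sum>l'\<in>UNIV. pmf (Q a b l) l' * F (h @ [(k, l, a, b)], k', l'))))"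
  have "measure_pmf.expectation (play P Q p q \<sigma> \<tau> (Suc t)) F =
      measure_pmf.expectation (play P Q p q \<sigma> \<tau> t) ?step"
    by (simp add: expectation_bind finite_set_pmf_play expectation_finite case_prod_unfold)
  also have "\<dots> = (\<Sum>h | length h = Suc t. \<Sum>k\<in>UNIV. \<Sum>l\<in>UNIV.
      reach p P \<sigma> (view1 h, k) * reach2 q Q \<tau> (view2 h, l) * F (h, k, l))"
    unfolding Suc sum_lists_Suc sum_UNIV_prod
    by (intro sum.cong refl)
       (simp add: view1_def view2_def plan_def sum_distrib_left mult_ac)
  finally show ?case .
qed

lemma view_simps [simp]:
  "view1 (h @ [(k, l, a, b)]) = view1 h @ [(k, a, b)]"
  "view2 (h @ [(k, l, a, b)]) = view2 h @ [(l, a, b)]"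
  "view1 [] = []" "view2 [] = []"
  by (simp_all add: view1_def view2_def)

lemma discounted_sum_snoc:
  assumes "length h = n"
  shows "discounted_sum G lam (Suc n) (h @ [(k, l, a, b)]) =
    discounted_sum G lam n h + lam ^ n * G k l a b"
proof -
  have "(\<Sum>t = 1..n. lam ^ (t - 1) * (case (h @ [(k, l, a, b)]) ! (t - 1) of (k, l, a, b) \<Rightarrow> G k l a b)) =
      (\<Sum>t = 1..n. lam ^ (t - 1) * (case h ! (t - 1) of (k, l, a, b) \<Rightarrow> G k l a b))"
    using assms by (intro sum.cong refl) (auto simp: nth_append)
  then show ?thesis using assms by (simp add: discounted_sum_def nth_append)
qed

text \<open>Induction on the horizon: adding a stage adds its own term, and summing out the last
  choices of the earlier terms leaves the payoff of the shorter game.\<close>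

lemma payoff_eq_sum_plans:
  fixes G :: "'k::finite \<Rightarrow> 'l::finite \<Rightarrow> 'a::finite \<Rightarrow> 'b::finite \<Rightarrow> real"
  shows "payoff G P Q lam n p q \<sigma> \<tau> =
    (\<Sum>t<n. \<Sum>h | length h = t. \<Sum>k\<in>UNIV. \<Sum>l\<in>UNIV. \<Sum>a\<in>UNIV. \<Sum>b\<in>UNIV.
      plan p P \<sigma> (view1 h, k) a * plan2 q Q \<tau> (view2 h, l) b * (lam ^ t * G k l a b))"
proof (induction n)
  case 0
  then show ?case by (simp add: payoff_def discounted_sum_def case_prod_unfold)
next
  case (Suc n)
  let ?x = "\<lambda>h k a. plan p P \<sigma> (view1 h, k) a" and ?y = "\<lambda>h l b. plan2 q Q \<tau> (view2 h, l) b"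
  \<comment> \<open>The states drawn after the last stage do not affect the payoff and are summed
    out.\<close>
  have reach: "(\<Sum>k'\<in>UNIV. \<Sum>l'\<in>UNIV. reach p P \<sigma> (view1 (h @ [(k, l, a, b)]), k') *
      reach2 q Q \<tau> (view2 (h @ [(k, l, a, b)]), l') * c) = ?x h k a * ?y h l b * c" for h k l a b c
  proof -
    have "(\<Sum>k'\<in>UNIV. \<Sum>l'\<in>UNIV. reach p P \<sigma> (view1 (h @ [(k, l, a, b)]), k') *
        reach2 q Q \<tau> (view2 (h @ [(k, l, a, b)]), l') * c) =
        (\<Sum>k'\<in>UNIV. pmf (P a b k) k') * (\<Sum>l'\<in>UNIV. pmf (Q a b l) l') * (?x h k a * ?y h l b * c)"
      by (subst sum_product, simp only: sum_distrib_right) (simp add: mult_ac)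
    then show ?thesis by (simp add: sum_pmf_UNIV)
  qed
  \<comment> \<open>Payoffs of earlier stages do not depend on the last actions, and plans sum to
    reaches over these actions.\<close>
  have joint: "(\<Sum>a\<in>UNIV. \<Sum>b\<in>UNIV. ?x h k a * ?y h l b * c) =
      reach p P \<sigma> (view1 h, k) * reach2 q Q \<tau> (view2 h, l) * c" for h k l c
  proof -
    have "(\<Sum>a\<in>UNIV. \<Sum>b\<in>UNIV. ?x h k a * ?y h l b * c) =
        (\<Sum>a\<in>UNIV. ?x h k a) * (\<Sum>b\<in>UNIV. ?y h l b) * c"
      by (subst sum_product, simp only: sum_distrib_right)
    then show ?thesis by (simp only: sum_plan)
  qed
  have "payoff G P Q lam (Suc n) p q \<sigma> \<tau> =
      (\<Sum>h | length h = n. \<Sum>k\<in>UNIV. \<Sum>l\<in>UNIV. \<Sum>a\<in>UNIV. \<Sum>b\<in>UNIV.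
        ?x h k a * ?y h l b * discounted_sum G lam (Suc n) (h @ [(k, l, a, b)]))"
    unfolding payoff_def expectation_play sum_lists_Suc sum_UNIV_prod case_prod_conv reach ..
  also have "\<dots> = (\<Sum>h | length h = n. \<Sum>k\<in>UNIV. \<Sum>l\<in>UNIV. \<Sum>a\<in>UNIV. \<Sum>b\<in>UNIV.
        ?x h k a * ?y h l b * discounted_sum G lam n h + ?x h k a * ?y h l b * (lam ^ n * G k l a b))"
    by (intro sum.cong refl) (simp add: discounted_sum_snoc distrib_left)
  also have "\<dots> = payoff G P Q lam n p q \<sigma> \<tau> +
      (\<Sum>h | length h = n. \<Sum>k\<in>UNIV. \<Sum>l\<in>UNIV. \<Sum>a\<in>UNIV. \<Sum>b\<in>UNIV.
        ?x h k a * ?y h l b * (lam ^ n * G k l a b))"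
    unfolding sum.distrib joint payoff_def expectation_play case_prod_conv ..
  finally show ?case by (simp only: Suc sum.lessThan_Suc)
qed

section \<open>Regrouping joint histories by the private history of player 2\<close>

lemma matching_eq: "matching (g, l) = {h. map snd h = map snd g} \<times> UNIV"
  by (auto simp: matching_def)

lemma finite_same_actions:
  "finite {h :: ('k::finite \<times> 'c::finite) list. map snd h = map snd (g :: ('l \<times> 'c) list)}"
  by (rule finite_subset[OF _ finite_lists_length[of "length g"]]) (auto dest: map_eq_imp_length_eq)

lemma map_zip_view:
  assumes "map snd h = map snd g"
  shows "view1 (map (\<lambda>((l, c), k, _). (k, l, c)) (zip g h)) = h"
    and "view2 (map (\<lambda>((l, c), k, _). (k, l, c)) (zip g h)) = g"
  using assms
proof (induction h arbitrary: g)
  case (Cons x h)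
  { case 1 then show ?case using Cons by (cases g; cases x) (auto simp: view1_def) }
  { case 2 then show ?case using Cons by (cases g; cases x) (auto simp: view2_def) }
qed (simp_all add: view1_def view2_def)

text \<open>A joint history is the same as a pair of private histories with equal action sequences;
  zipping glues such a pair together. This produces the sums over matching histories in the
  constraints of the program.\<close>

lemma sum_matching:
  fixes F :: "('k::finite, 'a::finite, 'b::finite) history \<Rightarrow> ('l::finite, 'a, 'b) history \<Rightarrow> real"
  shows "(\<Sum>h | length h = t. \<Sum>k\<in>UNIV. \<Sum>l\<in>UNIV. F (view1 h, k) (view2 h, l)) =
    (\<Sum>g | length g = t. \<Sum>l\<in>UNIV. \<Sum>I\<in>matching (g, l). F I (g, l))"
proof -
  have "(\<Sum>g | length g = t. \<Sum>l\<in>UNIV. \<Sum>I\<in>matching (g, l). F I (g, l)) =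
      (\<Sum>g | length g = t. \<Sum>l\<in>UNIV. \<Sum>h | map snd h = map snd g. \<Sum>k\<in>UNIV. F (h, k) (g, l))"
    by (simp add: matching_eq sum.cartesian_product)
  also have "\<dots> = (\<Sum>g | length g = t. \<Sum>h | map snd h = map snd g. \<Sum>k\<in>UNIV. \<Sum>l\<in>UNIV. F (h, k) (g, l))"
    by (subst (2) sum.swap, subst (3) sum.swap) simp
  also have "\<dots> = (\<Sum>(g, h)\<in>Sigma {g. length g = t} (\<lambda>g. {h. map snd h = map snd g}).
      \<Sum>k\<in>UNIV. \<Sum>l\<in>UNIV. F (h, k) (g, l))"
    by (rule sum.Sigma) (auto intro: finite_lists_length finite_same_actions)
  also have "\<dots> = (\<Sum>h | length h = t. \<Sum>k\<in>UNIV. \<Sum>l\<in>UNIV. F (view1 h, k) (view2 h, l))"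
  proof (rule sum.reindex_bij_witness[where j = "\<lambda>(g, h). map (\<lambda>((l, c), k, _). (k, l, c)) (zip g h)"
        and i = "\<lambda>h. (view2 h, view1 h)"])
    fix h :: "('k \<times> 'l \<times> 'a \<times> 'b) list" assume h: "h \<in> {h. length h = t}"
    then show "(view2 h, view1 h) \<in> Sigma {g. length g = t} (\<lambda>g. {h. map snd h = map snd g})"
      by (auto simp: view1_def view2_def)
    have "map (\<lambda>((l, c), k, _). (k, l, c)) (zip (view2 h) (view1 h)) = h"
      by (induction h) (auto simp: view1_def view2_def)
    then show "(case (view2 h, view1 h) of (g, h) \<Rightarrow> map (\<lambda>((l, c), k, _). (k, l, c)) (zip g h)) = h"
      by simp
  qed (auto simp: map_zip_view dest: map_eq_imp_length_eq)
  finally show ?thesis ..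
qed

definition stage_payoff where
  "stage_payoff G lam R J b =
    (\<Sum>I\<in>matching J. \<Sum>a\<in>UNIV. R I a * lam ^ length (fst J) * G (snd I) (snd J) a b)"

text \<open>The actions of player 1 are summed without weights because the intended \<open>U\<close>
  is unnormalized: the probabilities of his choices are already contained in the plan
  \<open>R\<close> that enters the stage payoffs.\<close>

definition continuation where
  "continuation Q U J b =
    (\<Sum>l'\<in>UNIV. \<Sum>a\<in>UNIV. pmf (Q a b (snd J)) l' * U (fst J @ [(snd J, a, b)], l'))"

lemma payoff_eq_stage_payoffs:
  fixes G :: "'k::finite \<Rightarrow> 'l::finite \<Rightarrow> 'a::finite \<Rightarrow> 'b::finite \<Rightarrow> real"
  shows "payoff G P Q lam n p q \<sigma> \<tau> = (\<Sum>t<n. \<Sum>g | length g = t. \<Sum>l\<in>UNIV. \<Sum>b\<in>UNIV.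
    plan2 q Q \<tau> (g, l) b * stage_payoff G lam (plan p P \<sigma>) (g, l) b)"
proof -
  have "(\<Sum>h | length h = t. \<Sum>k\<in>UNIV. \<Sum>l\<in>UNIV. \<Sum>a\<in>UNIV. \<Sum>b\<in>UNIV.
      plan p P \<sigma> (view1 h, k) a * plan2 q Q \<tau> (view2 h, l) b * (lam ^ t * G k l a b)) =
    (\<Sum>g | length g = t. \<Sum>l\<in>UNIV. \<Sum>b\<in>UNIV.
      plan2 q Q \<tau> (g, l) b * stage_payoff G lam (plan p P \<sigma>) (g, l) b)" for t
  proof -
    have "(\<Sum>I\<in>matching (g, l). \<Sum>a\<in>UNIV. \<Sum>b\<in>UNIV.
        plan p P \<sigma> I a * plan2 q Q \<tau> (g, l) b * (lam ^ t * G (snd I) l a b)) =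
      (\<Sum>b\<in>UNIV. plan2 q Q \<tau> (g, l) b * stage_payoff G lam (plan p P \<sigma>) (g, l) b)"
      if "length g = t" for g l
    proof -
      have "(\<Sum>I\<in>matching (g, l). \<Sum>a\<in>UNIV. \<Sum>b\<in>UNIV.
          plan p P \<sigma> I a * plan2 q Q \<tau> (g, l) b * (lam ^ t * G (snd I) l a b)) =
        (\<Sum>b\<in>UNIV. \<Sum>I\<in>matching (g, l). \<Sum>a\<in>UNIV.
          plan p P \<sigma> I a * plan2 q Q \<tau> (g, l) b * (lam ^ t * G (snd I) l a b))"
        by (subst (2) sum.swap, subst sum.swap) simp
      then show ?thesis
        using that by (simp add: stage_payoff_def sum_distrib_left mult_ac)
    qed
    then show ?thesis
      using sum_matching[of "\<lambda>I J. \<Sum>a\<in>UNIV. \<Sum>b\<in>UNIV.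
        plan p P \<sigma> I a * plan2 q Q \<tau> J b * (lam ^ t * G (snd I) (snd J) a b)" t]
      by (simp add: mult_ac)
  qed
  then show ?thesis by (simp only: payoff_eq_sum_plans)
qed

lemma sum_reach2_Suc:
  fixes U :: "('l::finite, 'a::finite, 'b::finite) history \<Rightarrow> real"
  shows "(\<Sum>g | length g = Suc t. \<Sum>l\<in>UNIV. reach2 q Q \<tau> (g, l) * U (g, l)) =
    (\<Sum>g | length g = t. \<Sum>l\<in>UNIV. \<Sum>b\<in>UNIV. plan2 q Q \<tau> (g, l) b * continuation Q U (g, l) b)"
proof -
  have "(\<Sum>a\<in>UNIV. \<Sum>b\<in>UNIV. \<Sum>l'\<in>UNIV. reach2 q Q \<tau> (g @ [(l, a, b)], l') * U (g @ [(l, a, b)], l')) =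
      (\<Sum>b\<in>UNIV. plan2 q Q \<tau> (g, l) b * continuation Q U (g, l) b)" for g l
  proof -
    have "(\<Sum>a\<in>UNIV. \<Sum>b\<in>UNIV. \<Sum>l'\<in>UNIV. reach2 q Q \<tau> (g @ [(l, a, b)], l') * U (g @ [(l, a, b)], l')) =
        (\<Sum>b\<in>UNIV. \<Sum>l'\<in>UNIV. \<Sum>a\<in>UNIV. reach2 q Q \<tau> (g @ [(l, a, b)], l') * U (g @ [(l, a, b)], l'))"
      by (subst sum.swap, subst (2) sum.swap) simp
    then show ?thesis by (simp add: continuation_def sum_distrib_left mult_ac)
  qed
  then show ?thesis by (simp only: sum_lists_Suc sum_UNIV_prod)
qed

text \<open>Let \<open>D t\<close> be the sum of \<open>U\<close> over pasts of length
  \<open>t\<close>, weighted with the reach of player 2. Then \<open>D 0\<close> is the left side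
  and \<open>D n\<close> vanishes. Passing to \<open>D (Suc t)\<close> replaces \<open>U\<close> by
  its continuation, with the plan as weight, so the sum telescopes for every
  \<open>\<tau>\<close>.\<close>

lemma sum_initial_eq_telescope:
  fixes U :: "('l::finite, 'a::finite, 'b::finite) history \<Rightarrow> real"
  assumes "\<And>g l. length g = n \<Longrightarrow> U (g, l) = 0"
  shows "(\<Sum>l\<in>UNIV. pmf q l * U ([], l)) = (\<Sum>t<n. \<Sum>g | length g = t. \<Sum>l\<in>UNIV. \<Sum>b\<in>UNIV.
    plan2 q Q \<tau> (g, l) b * (U (g, l) - continuation Q U (g, l) b))"
proof -
  define D where "D t = (\<Sum>g | length g = t. \<Sum>l\<in>UNIV. reach2 q Q \<tau> (g, l) * U (g, l))" for t
  have "D t - D (Suc t) = (\<Sum>g | length g = t. \<Sum>l\<in>UNIV. \<Sum>b\<in>UNIV.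
      plan2 q Q \<tau> (g, l) b * (U (g, l) - continuation Q U (g, l) b))" for t
  proof -
    have "D t = (\<Sum>g | length g = t. \<Sum>l\<in>UNIV. \<Sum>b\<in>UNIV. plan2 q Q \<tau> (g, l) b * U (g, l))"
      unfolding D_def sum_distrib_right[symmetric] sum_plan ..
    then show ?thesis
      unfolding D_def sum_reach2_Suc by (simp add: sum_subtractf right_diff_distrib)
  qed
  moreover have "(\<Sum>t<n. D t - D (Suc t)) = D 0 - D n"
    by (rule sum_lessThan_telescope')
  moreover have "D n = 0"
    unfolding D_def using assms by (intro sum.neutral ballI) auto
  moreover have "D 0 = (\<Sum>l\<in>UNIV. pmf q l * U ([], l))"
    by (simp add: D_def)
  ultimately show ?thesis by simp
qed

lemma payoff_eq_initial_plus_slack: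
  fixes G :: "'k::finite \<Rightarrow> 'l::finite \<Rightarrow> 'a::finite \<Rightarrow> 'b::finite \<Rightarrow> real"
  assumes "\<And>g l. length g = n \<Longrightarrow> U (g, l) = 0"
  shows "payoff G P Q lam n p q \<sigma> \<tau> = (\<Sum>l\<in>UNIV. pmf q l * U ([], l)) +
    (\<Sum>t<n. \<Sum>g | length g = t. \<Sum>l\<in>UNIV. \<Sum>b\<in>UNIV. plan2 q Q \<tau> (g, l) b *
      (stage_payoff G lam (plan p P \<sigma>) (g, l) b + continuation Q U (g, l) b - U (g, l)))"
proof -
  have "(\<Sum>l\<in>UNIV. pmf q l * U ([], l)) = (\<Sum>t<n. \<Sum>g | length g = t. \<Sum>l\<in>UNIV. \<Sum>b\<in>UNIV.
      plan2 q Q \<tau> (g, l) b * (U (g, l) - continuation Q U (g, l) b))"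
    using assms by (rule sum_initial_eq_telescope)
  then show ?thesis
    unfolding payoff_eq_stage_payoffs
    by (simp add: right_diff_distrib distrib_left sum.distrib sum_subtractf)
qed

section \<open>Security levels of player 1\<close>

lemma lp1_feasible_iff:
  "lp1_feasible G P Q lam n p (R, U) \<longleftrightarrow> is_plan p P n R \<and>
    (\<forall>J b. length (fst J) < n \<longrightarrow> U J \<le> stage_payoff G lam R J b + continuation Q U J b) \<and>
    (\<forall>J. length (fst J) = n \<longrightarrow> U J = 0)"
  by (auto simp: lp1_feasible_def is_plan_def stage_payoff_def continuation_def)

section \<open>Backward induction against a fixed plan\<close>

primrec bellman where
  "bellman G Q lam R 0 J = 0"
| "bellman G Q lam R (Suc m) J =
    Min (range (\<lambda>b. stage_payoff G lam R J b + continuation Q (bellman G Q lam R m) J b))"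

text \<open>The cost-to-go of a best response of player 2 to \<open>R\<close>, unnormalized like
  \<open>U\<close>. The recursion counts the stages still to be played, and here that count is read
  off the history.\<close>

definition response_value where
  "response_value G Q lam n R J = bellman G Q lam R (n - length (fst J)) J"

lemma response_value_final: "length (fst J) = n \<Longrightarrow> response_value G Q lam n R J = 0"
  by (simp add: response_value_def)

lemma response_value_rec:
  assumes "length (fst J) < n"
  shows "response_value G Q lam n R J = Min (range (\<lambda>b.
    stage_payoff G lam R J b + continuation Q (response_value G Q lam n R) J b))"
proof -
  \<comment> \<open>The continuation looks only at pasts longer by one, where one stage fewer
    remains.\<close>
  have "continuation Q (response_value G Q lam n R) J b =
      continuation Q (bellman G Q lam R (n - Suc (length (fst J)))) J b" for b
    by (simp add: continuation_def response_value_def)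
  moreover have "n - length (fst J) = Suc (n - Suc (length (fst J)))" using assms by simp
  ultimately show ?thesis by (simp add: response_value_def)
qed

lemma response_value_feasible:
  fixes G :: "'k::finite \<Rightarrow> 'l::finite \<Rightarrow> 'a::finite \<Rightarrow> 'b::finite \<Rightarrow> real"
  shows "is_plan p P n R \<Longrightarrow> lp1_feasible G P Q lam n p (R, response_value G Q lam n R)"
  by (auto simp: lp1_feasible_iff response_value_rec response_value_final intro!: Min_le)

text \<open>Matching histories have the same length as \<open>J\<close>, hence lie within the
  horizon, where \<open>R\<close> and the plan of \<open>\<sigma>\<close> agree.\<close>

lemma stage_payoff_induced:
  fixes G :: "'k::finite \<Rightarrow> 'l::finite \<Rightarrow> 'a::finite \<Rightarrow> 'b::finite \<Rightarrow> real"
    and J :: "('l, 'a, 'b) history"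
  assumes "is_plan p P n R" "induced1 P n p R \<sigma>" "length (fst J) < n"
  shows "stage_payoff G lam (plan p P \<sigma>) J b = stage_payoff G lam R J b"
  unfolding stage_payoff_def
proof (intro sum.cong refl)
  fix I :: "('k, 'a, 'b) history" and a assume "I \<in> matching J"
  then have "length (fst I) < n"
    using assms(3) by (auto simp: matching_def dest!: map_eq_imp_length_eq)
  then show "plan p P \<sigma> I a * lam ^ length (fst J) * G (snd I) (snd J) a b =
      R I a * lam ^ length (fst J) * G (snd I) (snd J) a b"
    using plan_unique[OF assms(1,2), of "fst I" "snd I" a] by simp
qed

lemma payoff_eq_plan_slack:
  fixes G :: "'k::finite \<Rightarrow> 'l::finite \<Rightarrow> 'a::finite \<Rightarrow> 'b::finite \<Rightarrow> real"
  assumes "is_plan p P n R" "induced1 P n p R \<sigma>" "\<And>J. length (fst J) = n \<Longrightarrow> U J = 0"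
  shows "payoff G P Q lam n p q \<sigma> \<tau> = (\<Sum>l\<in>UNIV. pmf q l * U ([], l)) +
    (\<Sum>t<n. \<Sum>g | length g = t. \<Sum>l\<in>UNIV. \<Sum>b\<in>UNIV. plan2 q Q \<tau> (g, l) b *
      (stage_payoff G lam R (g, l) b + continuation Q U (g, l) b - U (g, l)))"
proof -
  have "payoff G P Q lam n p q \<sigma> \<tau> = (\<Sum>l\<in>UNIV. pmf q l * U ([], l)) +
    (\<Sum>t<n. \<Sum>g | length g = t. \<Sum>l\<in>UNIV. \<Sum>b\<in>UNIV. plan2 q Q \<tau> (g, l) b *
      (stage_payoff G lam (plan p P \<sigma>) (g, l) b + continuation Q U (g, l) b - U (g, l)))"
    using assms(3) by (intro payoff_eq_initial_plus_slack) simp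
  also have "(\<Sum>t<n. \<Sum>g | length g = t. \<Sum>l\<in>UNIV. \<Sum>b\<in>UNIV. plan2 q Q \<tau> (g, l) b *
      (stage_payoff G lam (plan p P \<sigma>) (g, l) b + continuation Q U (g, l) b - U (g, l))) =
    (\<Sum>t<n. \<Sum>g | length g = t. \<Sum>l\<in>UNIV. \<Sum>b\<in>UNIV. plan2 q Q \<tau> (g, l) b *
      (stage_payoff G lam R (g, l) b + continuation Q U (g, l) b - U (g, l)))"
    by (intro sum.cong refl) (simp add: stage_payoff_induced[OF assms(1,2)])
  finally show ?thesis .
qed

text \<open>Feasibility makes all slacks nonnegative, and so are the weights in the plan of player
  2. Neither feasibility nor \<open>\<sigma>\<close> refers to \<open>q\<close>, so the bound holds
  for every initial law of player 2 simultaneously.\<close>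

lemma lp1_objective_le_payoff:
  fixes G :: "'k::finite \<Rightarrow> 'l::finite \<Rightarrow> 'a::finite \<Rightarrow> 'b::finite \<Rightarrow> real"
  assumes feas: "lp1_feasible G P Q lam n p (R, U)" and ind: "induced1 P n p R \<sigma>"
  shows "lp1_objective q (R, U) \<le> payoff G P Q lam n p q \<sigma> \<tau>"
proof -
  have "0 \<le> (\<Sum>t<n. \<Sum>g | length g = t. \<Sum>l\<in>UNIV. \<Sum>b\<in>UNIV. plan2 q Q \<tau> (g, l) b *
      (stage_payoff G lam R (g, l) b + continuation Q U (g, l) b - U (g, l)))"
    using feas by (intro sum_nonneg mult_nonneg_nonneg plan_nonneg) (auto simp: lp1_feasible_iff)
  moreover have "is_plan p P n R" "\<And>J. length (fst J) = n \<Longrightarrow> U J = 0"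
    using feas by (auto simp: lp1_feasible_iff)
  ultimately show ?thesis
    using payoff_eq_plan_slack[of p P n R \<sigma> U G Q lam q \<tau>] ind by (simp add: lp1_objective_def)
qed

text \<open>Player 2 plays a minimizing action at every history. The slack of that action is zero,
  and all other actions get weight zero from his plan.\<close>

lemma response_value_attained:
  fixes G :: "'k::finite \<Rightarrow> 'l::finite \<Rightarrow> 'a::finite \<Rightarrow> 'b::finite \<Rightarrow> real"
  assumes plan: "is_plan p P n R" and ind: "induced1 P n p R \<sigma>"
  shows "\<exists>\<tau>. payoff G P Q lam n p q \<sigma> \<tau> = lp1_objective q (R, response_value G Q lam n R)"
proof -
  let ?U = "response_value G Q lam n R"
  have "\<exists>b. length (fst J) < n \<longrightarrow> ?U J = stage_payoff G lam R J b + continuation Q ?U J b" for J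
  proof (cases "length (fst J) < n")
    case True
    have "?U J \<in> range (\<lambda>b. stage_payoff G lam R J b + continuation Q ?U J b)"
      unfolding response_value_rec[OF True] by (intro Min_in) auto
    then show ?thesis by blast
  qed simp
  then obtain \<beta> where \<beta>: "\<And>J. length (fst J) < n \<Longrightarrow>
      ?U J = stage_payoff G lam R J (\<beta> J) + continuation Q ?U J (\<beta> J)"
    by metis
  define \<tau> where "\<tau> J = return_pmf (\<beta> J)" for J
  have "plan2 q Q \<tau> (g, l) b *
      (stage_payoff G lam R (g, l) b + continuation Q ?U (g, l) b - ?U (g, l)) = 0"
    if "length g < n" for g l b
    using that \<beta>[of "(g, l)"] unfolding plan2_eq
    by (cases "b = \<beta> (g, l)") (simp_all add: \<tau>_def)
  then have "(\<Sum>t<n. \<Sum>g | length g = t. \<Sum>l\<in>UNIV. \<Sum>b\<in>UNIV. plan2 q Q \<tau> (g, l) b *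
      (stage_payoff G lam R (g, l) b + continuation Q ?U (g, l) b - ?U (g, l))) = 0"
    by (intro sum.neutral ballI) auto
  then show ?thesis
    using payoff_eq_plan_slack[OF plan ind, of ?U G Q lam q \<tau>]
    by (auto simp: lp1_objective_def response_value_final)
qed

text \<open>The bound for the backward induction solution and its attainment together show that the
  \<open>LEAST\<close> element exists and is this number.\<close>

lemma guarantee1_induced:
  fixes G :: "'k::finite \<Rightarrow> 'l::finite \<Rightarrow> 'a::finite \<Rightarrow> 'b::finite \<Rightarrow> real"
  assumes "is_plan p P n R" "induced1 P n p R \<sigma>"
  shows "guarantee1 G P Q lam n p q \<sigma> = lp1_objective q (R, response_value G Q lam n R)"
  unfolding guarantee1_def
proof (rule Least_equality)
  show "lp1_objective q (R, response_value G Q lam n R) \<in> range (payoff G P Q lam n p q \<sigma>)"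
    using response_value_attained[OF assms, of G Q lam q] by (metis rangeI)
  show "lp1_objective q (R, response_value G Q lam n R) \<le> x"
    if "x \<in> range (payoff G P Q lam n p q \<sigma>)" for x
    using that lp1_objective_le_payoff[OF response_value_feasible[OF assms(1)] assms(2)] by blast
qed

text \<open>Results about a plan and a strategy induced by it thereby cover arbitrary
  strategies.\<close>

lemma induced1_plan: "induced1 P n p (plan p P \<sigma>) \<sigma>"
  by (auto simp: induced1_def inflow1_plan plan_def)

lemma guarantee1_le_payoff:
  fixes G :: "'k::finite \<Rightarrow> 'l::finite \<Rightarrow> 'a::finite \<Rightarrow> 'b::finite \<Rightarrow> real"
  shows "guarantee1 G P Q lam n p q \<sigma> \<le> payoff G P Q lam n p q \<sigma> \<tau>"
  unfolding guarantee1_induced[OF is_plan_plan induced1_plan]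
  using lp1_objective_le_payoff[OF response_value_feasible[OF is_plan_plan] induced1_plan] .

lemma guarantee1_attained:
  fixes G :: "'k::finite \<Rightarrow> 'l::finite \<Rightarrow> 'a::finite \<Rightarrow> 'b::finite \<Rightarrow> real"
  shows "\<exists>\<tau>. payoff G P Q lam n p q \<sigma> \<tau> = guarantee1 G P Q lam n p q \<sigma>"
  unfolding guarantee1_induced[OF is_plan_plan induced1_plan]
  by (rule response_value_attained[OF is_plan_plan induced1_plan])

text \<open>Starting from \<open>l\<close> is the game in which player 2 has the law
  \<open>return_pmf l\<close>. The formula for the guarantee holds for every law, with a response
  value that does not depend on it.\<close>

lemma alpha_induced:
  fixes G :: "'k::finite \<Rightarrow> 'l::finite \<Rightarrow> 'a::finite \<Rightarrow> 'b::finite \<Rightarrow> real"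
  assumes "is_plan p P n R" "induced1 P n p R \<sigma>"
  shows "alpha G P Q lam n p \<sigma> l = response_value G Q lam n R ([], l)"
proof -
  have "alpha G P Q lam n p \<sigma> l = guarantee1 G P Q lam n p (return_pmf l) \<sigma>"
    by (simp add: alpha_def guarantee1_def)
  then show ?thesis
    by (simp add: guarantee1_induced[OF assms] lp1_objective_def indicator_def if_distrib
        flip: of_bool_def cong: if_cong)
qed

text \<open>A strategy yields a feasible point whose objective is its guarantee, namely its plan
  with the response value. Conversely the objective of a feasible point is at most the guarantee of
  any strategy that it induces.\<close>

lemma lp1_maximum:
  fixes G :: "'k::finite \<Rightarrow> 'l::finite \<Rightarrow> 'a::finite \<Rightarrow> 'b::finite \<Rightarrow> real"
  assumes max: "is_maximum (range (guarantee1 G P Q lam n p q)) v"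
  shows "is_maximum (lp1_objective q ` {x. lp1_feasible G P Q lam n p x}) v"
  unfolding is_maximum_def
proof
  obtain \<sigma> where "v = guarantee1 G P Q lam n p q \<sigma>"
    using max by (auto simp: is_maximum_def)
  then show "v \<in> lp1_objective q ` {x. lp1_feasible G P Q lam n p x}"
    using guarantee1_induced[OF is_plan_plan induced1_plan]
      response_value_feasible[OF is_plan_plan] by blast
  show "\<forall>x\<in>lp1_objective q ` {x. lp1_feasible G P Q lam n p x}. x \<le> v"
  proof
    fix x assume "x \<in> lp1_objective q ` {x. lp1_feasible G P Q lam n p x}"
    then obtain R U where RU: "lp1_feasible G P Q lam n p (R, U)" "x = lp1_objective q (R, U)"
      by auto
    then obtain \<sigma> where \<sigma>: "induced1 P n p R \<sigma>"
      using induced1_exists unfolding lp1_feasible_iff by blast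
    have "x \<le> guarantee1 G P Q lam n p q \<sigma>"
      using lp1_objective_le_payoff[OF RU(1) \<sigma>] guarantee1_attained[of G P Q lam n p q \<sigma>] RU(2)
      by metis
    also have "\<dots> \<le> v" using max by (simp add: is_maximum_def)
    finally show "x \<le> v" .
  qed
qed

text \<open>The response value \<open>?V\<close> of \<open>R\<close> is feasible and dominates
  \<open>U\<close> at the initial states, so by optimality both have the same objective and they
  agree where \<open>q\<close> is positive. Elsewhere the objective does not see \<open>U\<close>,
  which may lie below the vector payoff; replacing \<open>U\<close> by \<open>?V\<close> gives an
  optimal solution that matches it at every state.\<close>

lemma lp1_optimal_solution:
  fixes G :: "'k::finite \<Rightarrow> 'l::finite \<Rightarrow> 'a::finite \<Rightarrow> 'b::finite \<Rightarrow> real"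
  assumes max: "is_maximum (range (guarantee1 G P Q lam n p q)) v"
    and opt: "lp1_optimal G P Q lam n p q R U"
  shows "\<exists>\<sigma>. induced1 P n p R \<sigma>"
    and "induced1 P n p R \<sigma> \<Longrightarrow> optimal1 G P Q lam n p q \<sigma>"
    and "induced1 P n p R \<sigma> \<Longrightarrow> pmf q l > 0 \<Longrightarrow> nu G P Q lam n p \<sigma> l = - U ([], l)"
    and "induced1 P n p R \<sigma> \<Longrightarrow> \<exists>U'. lp1_optimal G P Q lam n p q R U' \<and>
      (\<forall>l. nu G P Q lam n p \<sigma> l = - U' ([], l))"
proof -
  let ?V = "response_value G Q lam n R"
  have feas: "lp1_feasible G P Q lam n p (R, U)"
    and opt': "\<And>x. lp1_feasible G P Q lam n p x \<Longrightarrow> lp1_objective q x \<le> lp1_objective q (R, U)"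
    using opt unfolding lp1_optimal_def is_arg_max_linorder by auto
  have plan: "is_plan p P n R" using feas by (simp add: lp1_feasible_iff)
  then show "\<exists>\<sigma>. induced1 P n p R \<sigma>" by (rule induced1_exists)
  have v: "lp1_objective q (R, U) = v"
  proof (rule antisym)
    show "lp1_objective q (R, U) \<le> v"
      using lp1_maximum[OF max] feas unfolding is_maximum_def by blast
    obtain x where "lp1_feasible G P Q lam n p x" "v = lp1_objective q x"
      using lp1_maximum[OF max] unfolding is_maximum_def by blast
    then show "v \<le> lp1_objective q (R, U)" using opt' by blast
  qed
  have V: "lp1_feasible G P Q lam n p (R, ?V)" by (rule response_value_feasible[OF plan])
  assume ind: "induced1 P n p R \<sigma>"
  \<comment> \<open>Evaluating both objectives at a point mass compares \<open>U\<close> and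
    \<open>?V\<close> state by state.\<close>
  have le: "U ([], l) \<le> ?V ([], l)" for l
  proof -
    have point: "lp1_objective (return_pmf l) (R, W) = W ([], l)" for W :: "('l, 'a, 'b) history \<Rightarrow> real"
      by (simp add: lp1_objective_def indicator_def if_distrib flip: of_bool_def cong: if_cong)
    show ?thesis
      using lp1_objective_le_payoff[OF feas ind, of "return_pmf l"]
        response_value_attained[OF plan ind, of G Q lam "return_pmf l"] by (metis point)
  qed
  have VU: "lp1_objective q (R, ?V) = v"
  proof (rule antisym)
    show "lp1_objective q (R, ?V) \<le> v" using opt'[OF V] v by simp
    show "v \<le> lp1_objective q (R, ?V)"
      unfolding v[symmetric] by (simp add: lp1_objective_def le sum_mono mult_left_mono)
  qed
  then have g: "guarantee1 G P Q lam n p q \<sigma> = v" by (simp add: guarantee1_induced[OF plan ind])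
  show "optimal1 G P Q lam n p q \<sigma>"
    using max unfolding optimal1_def is_arg_max_linorder g by (simp add: is_maximum_def)
  show "\<exists>U'. lp1_optimal G P Q lam n p q R U' \<and> (\<forall>l. nu G P Q lam n p \<sigma> l = - U' ([], l))"
    using V opt' VU v unfolding lp1_optimal_def is_arg_max_linorder
    by (intro exI[of _ ?V]) (simp add: nu_def alpha_induced[OF plan ind])
  assume l: "pmf q l > 0"
  \<comment> \<open>Equal objectives make this sum of nonnegative terms zero, so each term is
    zero.\<close>
  have "(\<Sum>l\<in>UNIV. pmf q l * (?V ([], l) - U ([], l))) = 0"
    using VU v by (simp add: lp1_objective_def right_diff_distrib sum_subtractf)
  then have "pmf q l * (?V ([], l) - U ([], l)) = 0"
    using le by (subst (asm) sum_nonneg_eq_0_iff) auto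
  then show "nu G P Q lam n p \<sigma> l = - U ([], l)"
    using l by (simp add: nu_def alpha_induced[OF plan ind])
qed

section \<open>Exchanging the players\<close>

text \<open>Written with plans, the payoff treats the players symmetrically; reversing the roles in
  every stage of a joint history permutes the terms, and the sign comes from
  \<open>- G\<close>.\<close>

lemma payoff_swap:
  fixes G :: "'k::finite \<Rightarrow> 'l::finite \<Rightarrow> 'a::finite \<Rightarrow> 'b::finite \<Rightarrow> real"
  shows "payoff (\<lambda>l k b a. - G k l a b) (\<lambda>b a. Q a b) (\<lambda>b a. P a b) lam n q p
      (\<lambda>J. \<tau> (swap_history J)) (\<lambda>I. \<sigma> (swap_history I)) = - payoff G P Q lam n p q \<sigma> \<tau>"
proof -
  let ?turn = "\<lambda>(k, l, a, b). (l, k, b, a)"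
  let ?y = "plan q (\<lambda>b a. Q a b) (\<lambda>J. \<tau> (swap_history J))"
  have view: "view1 (map ?turn h) = swap_actions (view2 h)" "view2 (map ?turn h) = swap_actions (view1 h)"
    for h :: "('k \<times> 'l \<times> 'a \<times> 'b) list"
    by (simp_all add: view1_def view2_def swap_actions_def case_prod_unfold)
  \<comment> \<open>Its type variables are independent of those of the game, as it is applied to
    joint histories of both the game and its mirror.\<close>
  have turn: "map (\<lambda>(k, l, a, b). (l, k, b, a)) (map ?turn h) = h"
    for h :: "('x1 \<times> 'x2 \<times> 'x3 \<times> 'x4) list"
    by (induction h) auto
  have "(\<Sum>h | length h = t. \<Sum>l\<in>UNIV. \<Sum>k\<in>UNIV. \<Sum>b\<in>UNIV. \<Sum>a\<in>UNIV.
      ?y (view1 h, l) b * plan p P \<sigma> (swap_history (view2 h, k)) a * (lam ^ t * - G k l a b)) =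
    (\<Sum>h | length h = t. \<Sum>k\<in>UNIV. \<Sum>l\<in>UNIV. \<Sum>a\<in>UNIV. \<Sum>b\<in>UNIV.
      - (plan p P \<sigma> (view1 h, k) a * ?y (swap_history (view2 h, l)) b * (lam ^ t * G k l a b)))" for t
  proof (rule sum.reindex_bij_witness[where i = "map ?turn" and j = "map ?turn"])
    fix h :: "('l \<times> 'k \<times> 'b \<times> 'a) list"
    define h' where "h' = map ?turn h"
    have h: "h = map ?turn h'" unfolding h'_def turn ..
    show "(\<Sum>k\<in>UNIV. \<Sum>l\<in>UNIV. \<Sum>a\<in>UNIV. \<Sum>b\<in>UNIV.
        - (plan p P \<sigma> (view1 (map ?turn h), k) a * ?y (swap_history (view2 (map ?turn h), l)) b *
          (lam ^ t * G k l a b))) =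
      (\<Sum>l\<in>UNIV. \<Sum>k\<in>UNIV. \<Sum>b\<in>UNIV. \<Sum>a\<in>UNIV.
        ?y (view1 h, l) b * plan p P \<sigma> (swap_history (view2 h, k)) a * (lam ^ t * - G k l a b))"
      unfolding h view turn
      by (subst sum.swap, subst (3) sum.swap) (simp add: mult_ac)
  qed (simp_all add: turn del: map_map)
  then show ?thesis
    unfolding payoff_eq_sum_plans by (simp add: sum_negf)
qed

lemma payoff_swap_left:
  fixes G :: "'k::finite \<Rightarrow> 'l::finite \<Rightarrow> 'a::finite \<Rightarrow> 'b::finite \<Rightarrow> real"
  shows "payoff (\<lambda>l k b a. - G k l a b) (\<lambda>b a. Q a b) (\<lambda>b a. P a b) lam n q p
      (\<lambda>J. \<tau> (swap_history J)) \<sigma>' = - payoff G P Q lam n p q (\<lambda>I. \<sigma>' (swap_history I)) \<tau>"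
  using payoff_swap[of G Q P lam n q p \<tau> "\<lambda>I. \<sigma>' (swap_history I)"] by simp

text \<open>A maximum of payoffs is minus a minimum of negated payoffs, and
  \<open>swap_history\<close> matches the strategies of player 1 with those of player 2 in the
  mirrored game. Attainment is inherited from \<open>guarantee1_attained\<close>.\<close>

lemma guarantee2_eq_swap:
  fixes G :: "'k::finite \<Rightarrow> 'l::finite \<Rightarrow> 'a::finite \<Rightarrow> 'b::finite \<Rightarrow> real"
  shows "guarantee2 G P Q lam n p q \<tau> =
    - guarantee1 (\<lambda>l k b a. - G k l a b) (\<lambda>b a. Q a b) (\<lambda>b a. P a b) lam n q p (\<lambda>J. \<tau> (swap_history J))"
    (is "_ = - ?g")
  unfolding guarantee2_def
proof (rule Greatest_equality)
  obtain \<sigma>' where "payoff (\<lambda>l k b a. - G k l a b) (\<lambda>b a. Q a b) (\<lambda>b a. P a b) lam n q p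
      (\<lambda>J. \<tau> (swap_history J)) \<sigma>' = ?g"
    using guarantee1_attained by blast
  then show "- ?g \<in> range (\<lambda>\<sigma>. payoff G P Q lam n p q \<sigma> \<tau>)"
    unfolding payoff_swap_left by (intro range_eqI[of _ _ "\<lambda>I. \<sigma>' (swap_history I)"]) simp
  show "x \<le> - ?g" if "x \<in> range (\<lambda>\<sigma>. payoff G P Q lam n p q \<sigma> \<tau>)" for x
  proof -
    from that obtain \<sigma> where "x = payoff G P Q lam n p q \<sigma> \<tau>" by auto
    then show ?thesis
      using guarantee1_le_payoff[of "\<lambda>l k b a. - G k l a b" "\<lambda>b a. Q a b" "\<lambda>b a. P a b" lam n q p
          "\<lambda>J. \<tau> (swap_history J)" "\<lambda>I. \<sigma> (swap_history I)"]
      unfolding payoff_swap by simp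
  qed
qed

lemma payoff_le_guarantee2:
  fixes G :: "'k::finite \<Rightarrow> 'l::finite \<Rightarrow> 'a::finite \<Rightarrow> 'b::finite \<Rightarrow> real"
  shows "payoff G P Q lam n p q \<sigma> \<tau> \<le> guarantee2 G P Q lam n p q \<tau>"
  using guarantee1_le_payoff[of "\<lambda>l k b a. - G k l a b" "\<lambda>b a. Q a b" "\<lambda>b a. P a b" lam n q p
      "\<lambda>J. \<tau> (swap_history J)" "\<lambda>I. \<sigma> (swap_history I)"]
  unfolding payoff_swap guarantee2_eq_swap by simp

lemma guarantee2_attained:
  fixes G :: "'k::finite \<Rightarrow> 'l::finite \<Rightarrow> 'a::finite \<Rightarrow> 'b::finite \<Rightarrow> real"
  shows "\<exists>\<sigma>. payoff G P Q lam n p q \<sigma> \<tau> = guarantee2 G P Q lam n p q \<tau>"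
proof -
  obtain \<sigma>' where "payoff (\<lambda>l k b a. - G k l a b) (\<lambda>b a. Q a b) (\<lambda>b a. P a b) lam n q p
      (\<lambda>J. \<tau> (swap_history J)) \<sigma>' = guarantee1 (\<lambda>l k b a. - G k l a b) (\<lambda>b a. Q a b) (\<lambda>b a. P a b)
      lam n q p (\<lambda>J. \<tau> (swap_history J))"
    using guarantee1_attained by blast
  then show ?thesis
    unfolding payoff_swap_left guarantee2_eq_swap by (intro exI[of _ "\<lambda>I. \<sigma>' (swap_history I)"]) simp
qed


section \<open>Existence of the value\<close>

text \<open>The flow constraints are imposed at all histories, not only up to a horizon, so that
  every coordinate is bounded and the set can be compact in the product topology.\<close>

definition plans :: "'k pmf \<Rightarrow> ('a::finite \<Rightarrow> 'b \<Rightarrow> 'k \<Rightarrow> 'k pmf) \<Rightarrow>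
    (('k, 'a, 'b) history \<Rightarrow> 'a \<Rightarrow> real) set" where
  "plans p P = {R. \<forall>n. is_plan p P n R}"

lemma plans_iff:
  "R \<in> plans p P \<longleftrightarrow> (\<forall>I. (\<Sum>a\<in>UNIV. R I a) = inflow1 p P R I \<and> (\<forall>a. 0 \<le> R I a))"
  by (auto simp: plans_def is_plan_def)

lemma plan_in_plans: "plan p P \<sigma> \<in> plans p P"
  by (simp add: plans_def is_plan_plan)

lemma plans_nonempty: "plans p P \<noteq> {}"
  using plan_in_plans by blast

lemma plans_le_1:
  assumes R: "R \<in> plans p P"
  shows "R (h, k) a \<le> 1"
proof (induction h arbitrary: k a rule: rev_induct)
  case Nil
  have "R ([], k) a \<le> (\<Sum>a\<in>UNIV. R ([], k) a)"
    using R by (intro member_le_sum) (auto simp: plans_iff)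
  also have "\<dots> = pmf p k" using R by (simp add: plans_iff)
  finally show ?case using pmf_le_1[of p k] by simp
next
  case (snoc x h)
  obtain k' a' b where x: "x = (k', a', b)" by (cases x)
  have "R (h @ [x], k) a \<le> (\<Sum>a\<in>UNIV. R (h @ [x], k) a)"
    using R by (intro member_le_sum) (auto simp: plans_iff)
  also have "\<dots> = pmf (P a' b k') k * R (h, k') a'" using R by (simp add: plans_iff x)
  also have "\<dots> \<le> 1" using R snoc by (intro mult_le_one) (auto simp: plans_iff pmf_le_1)
  finally show ?case .
qed

lemma continuous_on_coordinate:
  "continuous_on UNIV (\<lambda>R :: 'i \<Rightarrow> 'j \<Rightarrow> 'c::topological_space. R i j)"
  by (rule continuous_on_product_then_coordinatewise[OF continuous_on_product_coordinates])

text \<open>Tychonoff's theorem, for function types carrying the product topology.\<close>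

lemma compact_PiE_UNIV:
  assumes "\<And>i. compact (S i :: 'c::topological_space set)"
  shows "compact (PiE UNIV S)"
  using compactin_PiE[of "\<lambda>_. euclidean" UNIV S] assms by (simp add: euclidean_product_topology)

text \<open>Each flow constraint is a closed condition on finitely many coordinates, so plans form a
  closed subset of a product of unit intervals.\<close>

lemma compact_plans: "compact (plans p P)"
proof -
  let ?box = "PiE UNIV (\<lambda>I. PiE UNIV (\<lambda>a. {0..1::real}))"
  have "compact ?box" by (intro compact_PiE_UNIV compact_Icc)
  moreover have "closed (plans p P)"
  proof -
    have inflow: "continuous_on UNIV (\<lambda>R. inflow1 p P R I)" for I
    proof (cases I)
      case (Pair h k)
      then show ?thesis
        by (cases h rule: snoc_cases)
          (auto intro!: continuous_on_mult continuous_on_const continuous_on_coordinate)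
    qed
    have "plans p P = {R. \<forall>I. (\<Sum>a\<in>UNIV. R I a) = inflow1 p P R I \<and> (\<forall>a. 0 \<le> R I a)}"
      using plans_iff by blast
    also have "closed \<dots>"
      by (intro closed_Collect_all closed_Collect_conj closed_Collect_eq closed_Collect_le
          continuous_on_sum continuous_on_coordinate continuous_on_const inflow)
    finally show ?thesis .
  qed
  ultimately have "compact (?box \<inter> plans p P)" by (rule compact_Int_closed)
  moreover have "plans p P \<subseteq> ?box"
    using plans_le_1 by (auto simp: plans_iff)
  ultimately show ?thesis by (simp add: Int_absorb1)
qed

lemma plans_mix:
  assumes "R \<in> plans p P" "R' \<in> plans p P" "0 \<le> t" "t \<le> 1"
  shows "(\<lambda>I a. t * R I a + (1 - t) * R' I a) \<in> plans p P"
proof -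
  have "inflow1 p P (\<lambda>I a. t * R I a + (1 - t) * R' I a) I =
      t * inflow1 p P R I + (1 - t) * inflow1 p P R' I" for I
  proof (cases I)
    case (Pair h k)
    then show ?thesis by (cases h rule: snoc_cases) (simp_all add: algebra_simps)
  qed
  then show ?thesis
    using assms by (auto simp: plans_iff sum.distrib simp flip: sum_distrib_left)
qed

text \<open>The payoff extends to a function \<open>f\<close> that is affine in each plan
  separately, so mixtures of plans satisfy the minimax hypotheses with equality. The saddle point in
  plans is then turned back into strategies.\<close>

lemma saddle_point_exists:
  fixes G :: "'k::finite \<Rightarrow> 'l::finite \<Rightarrow> 'a::finite \<Rightarrow> 'b::finite \<Rightarrow> real"
  shows "\<exists>\<sigma>0 \<tau>0. \<forall>\<sigma> \<tau>. payoff G P Q lam n p q \<sigma> \<tau>0 \<le> payoff G P Q lam n p q \<sigma>0 \<tau>"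
proof -
  \<comment> \<open>The second argument is a plan of player 2 in the mirrored game, so his histories
    are swapped before it is applied.\<close>
  define f :: "(('k, 'a, 'b) history \<Rightarrow> 'a \<Rightarrow> real) \<Rightarrow> (('l, 'b, 'a) history \<Rightarrow> 'b \<Rightarrow> real) \<Rightarrow> real"
    where "f R S = (\<Sum>t<n. \<Sum>h | length h = t. \<Sum>k\<in>UNIV. \<Sum>l\<in>UNIV. \<Sum>a\<in>UNIV. \<Sum>b\<in>UNIV.
      R (view1 h, k) a * S (swap_history (view2 h, l)) b * (lam ^ t * G k l a b))" for R S
  let ?Q = "\<lambda>b a. Q a b"
  have mix1: "f (\<lambda>I a. t * R I a + (1 - t) * R' I a) S = t * f R S + (1 - t) * f R' S" for t R R' S
    by (simp add: f_def sum_distrib_left sum.distrib[symmetric] algebra_simps)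
  have mix2: "f R (\<lambda>I a. t * S I a + (1 - t) * S' I a) = t * f R S + (1 - t) * f R S'" for t R S S'
    by (simp add: f_def sum_distrib_left sum.distrib[symmetric] algebra_simps)
  have "\<exists>R0\<in>plans p P. \<exists>S0\<in>plans q ?Q. \<forall>R\<in>plans p P. \<forall>S\<in>plans q ?Q. f R S0 \<le> f R0 S"
  proof (rule minimax_saddle_point)
    show "continuous_on UNIV (\<lambda>R. f R S)" for S
      unfolding f_def by (intro continuous_intros continuous_on_coordinate)
    show "continuous_on UNIV (\<lambda>S. f R S)" for R
      unfolding f_def by (intro continuous_intros continuous_on_coordinate)
  next
    fix R R' and t :: real assume "R \<in> plans p P" "R' \<in> plans p P" "0 \<le> t" "t \<le> 1"
    then show "\<exists>R''\<in>plans p P. \<forall>S\<in>plans q ?Q. t * f R S + (1 - t) * f R' S \<le> f R'' S"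
      by (intro bexI[OF _ plans_mix[of R p P R' t]]) (simp_all add: mix1)
  next
    fix S S' and t :: real assume "S \<in> plans q ?Q" "S' \<in> plans q ?Q" "0 \<le> t" "t \<le> 1"
    then show "\<exists>S''\<in>plans q ?Q. \<forall>R\<in>plans p P. f R S'' \<le> t * f R S + (1 - t) * f R S'"
      by (intro bexI[OF _ plans_mix[of S q ?Q S' t]]) (simp_all add: mix2)
  qed (rule compact_plans plans_nonempty)+
  then obtain R0 S0 where R0: "R0 \<in> plans p P" and S0: "S0 \<in> plans q ?Q"
    and saddle: "\<And>R S. R \<in> plans p P \<Longrightarrow> S \<in> plans q ?Q \<Longrightarrow> f R S0 \<le> f R0 S"
    by blast
  obtain \<sigma>0 where \<sigma>0: "induced1 P n p R0 \<sigma>0"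
    using R0 induced1_exists unfolding plans_def by blast
  obtain \<tau>0 where \<tau>0: "induced1 ?Q n q S0 \<tau>0"
    using S0 induced1_exists unfolding plans_def by blast
  have R0_eq: "R0 (h, k) a = plan p P \<sigma>0 (h, k) a" if "length h < n" for h k a
    using R0 plan_unique[OF _ \<sigma>0 that] unfolding plans_def by blast
  have S0_eq: "S0 (h, k) a = plan q ?Q \<tau>0 (h, k) a" if "length h < n" for h k a
    using S0 plan_unique[OF _ \<tau>0 that] unfolding plans_def by blast
  have length_view: "length (view1 h) = length h" "length (view2 h) = length h"
    for h :: "('k \<times> 'l \<times> 'a \<times> 'b) list"
    by (simp_all add: view1_def view2_def)
  have f_payoff: "payoff G P Q lam n p q \<sigma> \<tau> = f (plan p P \<sigma>) (plan q ?Q (\<lambda>J. \<tau> (swap_history J)))" for \<sigma> \<tau>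
    by (simp only: payoff_eq_sum_plans f_def)
  \<comment> \<open>Only pasts shorter than \<open>n\<close> occur in \<open>f\<close>, and there
    the induced strategies reproduce the plans of the saddle point.\<close>
  have "f R0 S = f (plan p P \<sigma>0) S" for S
    unfolding f_def by (intro sum.cong refl) (simp add: R0_eq length_view)
  moreover have "f R S0 = f R (plan q ?Q \<tau>0)" for R
    unfolding f_def by (intro sum.cong refl) (simp add: S0_eq length_view)
  ultimately have "payoff G P Q lam n p q \<sigma> (\<lambda>J. \<tau>0 (swap_history J)) \<le> payoff G P Q lam n p q \<sigma>0 \<tau>" for \<sigma> \<tau>
    using saddle[OF plan_in_plans plan_in_plans] by (simp add: f_payoff)
  then show ?thesis by blast
qed

text \<open>At a saddle point both guarantees equal the payoff there, and the saddle inequality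
  bounds all other guarantees by it; in particular \<open>GREATEST\<close> in
  \<open>game_value\<close> is attained.\<close>

lemma has_value_game_value:
  fixes G :: "'k::finite \<Rightarrow> 'l::finite \<Rightarrow> 'a::finite \<Rightarrow> 'b::finite \<Rightarrow> real"
  shows "has_value G P Q lam n p q (game_value G P Q lam n p q)"
proof -
  obtain \<sigma>0 \<tau>0 where saddle:
    "\<And>\<sigma> \<tau>. payoff G P Q lam n p q \<sigma> \<tau>0 \<le> payoff G P Q lam n p q \<sigma>0 \<tau>"
    using saddle_point_exists[of G P Q lam n p q] by blast
  define v where "v = payoff G P Q lam n p q \<sigma>0 \<tau>0"
  have g1: "guarantee1 G P Q lam n p q \<sigma>0 = v"
    using guarantee1_attained[of G P Q lam n p q \<sigma>0] guarantee1_le_payoff[of G P Q lam n p q \<sigma>0 \<tau>0]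
      saddle[of \<sigma>0] unfolding v_def by (metis antisym)
  have g1_le: "guarantee1 G P Q lam n p q \<sigma> \<le> v" for \<sigma>
    unfolding v_def using guarantee1_le_payoff saddle order_trans by blast
  have g2: "guarantee2 G P Q lam n p q \<tau>0 = v"
    using guarantee2_attained[of G P Q lam n p q \<tau>0] payoff_le_guarantee2[of G P Q lam n p q \<sigma>0 \<tau>0]
      saddle[of _ \<tau>0] unfolding v_def by (metis antisym)
  have g2_ge: "v \<le> guarantee2 G P Q lam n p q \<tau>" for \<tau>
    unfolding v_def using payoff_le_guarantee2 saddle order_trans by blast
  have "game_value G P Q lam n p q = v"
    unfolding game_value_def by (rule Greatest_equality) (use g1 g1_le in auto)
  then show ?thesis
    unfolding has_value_def is_maximum_def is_minimum_def
    using g1_le g2_ge rangeI[of "guarantee1 G P Q lam n p q" \<sigma>0]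
      rangeI[of "guarantee2 G P Q lam n p q" \<tau>0] by (auto simp: g1 g2)
qed


section \<open>The linear program of player 2\<close>

text \<open>Swapping is an involution, so it may be inserted under the quantifier over pasts when
  constraints of the two programs are compared.\<close>

lemma all_swap_actions: "(\<forall>h. A (swap_actions h)) \<longleftrightarrow> (\<forall>h. A h)"
  by (metis swap_actions_swap_actions)

lemma inflow1_swap:
  "inflow1 q (\<lambda>b a. Q a b) (\<lambda>J. S (swap_history J)) (h, l) = inflow2 q Q S (swap_actions h, l)"
  by (cases h rule: snoc_cases) (simp_all add: inflow2_def)

lemma induced2_iff_swap:
  "induced2 Q n q S \<tau> \<longleftrightarrow>
    induced1 (\<lambda>b a. Q a b) n q (\<lambda>J. S (swap_history J)) (\<lambda>J. \<tau> (swap_history J))"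
  unfolding induced1_def induced2_def
  by (subst all_swap_actions[symmetric]) (simp add: inflow1_swap)

lemma map_snd_swap_actions: "map snd (swap_actions h) = map prod.swap (map snd h)"
  by (induction h) (auto simp: swap_actions_def)

lemma swap_history_matching:
  "J \<in> matching (h, k) \<Longrightarrow> swap_history J \<in> matching (swap_actions h, k)"
  by (simp add: matching_def map_snd_swap_actions del: map_map)

lemma sum_matching_swap:
  "(\<Sum>I\<in>matching (swap_actions h, k). F I) = (\<Sum>J\<in>matching (h, k). F (swap_history J))"
proof (rule sum.reindex_bij_witness[where i = swap_history and j = swap_history])
  show "swap_history I \<in> matching (h, k)" if "I \<in> matching (swap_actions h, k)" for I
    using swap_history_matching[OF that] by simp
qed (simp_all add: swap_history_matching)

text \<open>The four groups of constraints correspond one to one. Negating \<open>G\<close> and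
  \<open>Z\<close> reverses the Bellman inequality, and the flow constraints are only
  relabelled.\<close>

lemma lp2_feasible_iff_swap:
  fixes G :: "'k::finite \<Rightarrow> 'l::finite \<Rightarrow> 'a::finite \<Rightarrow> 'b::finite \<Rightarrow> real"
  shows "lp2_feasible G P Q lam n q (S, Z) \<longleftrightarrow>
    lp1_feasible (\<lambda>l k b a. - G k l a b) (\<lambda>b a. Q a b) (\<lambda>b a. P a b) lam n q
      (\<lambda>J. S (swap_history J), \<lambda>I. - Z (swap_history I))"
  unfolding lp1_feasible_def lp2_feasible_def prod.case
proof (intro arg_cong2[where f = conj], goal_cases)
  case 1
  have "- z \<le> - x - y \<longleftrightarrow> x + y \<le> z" for x y z :: real by linarith
  then show ?case
    by (subst all_swap_actions[symmetric]) (simp add: sum_matching_swap sum_negf)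
next
  case 2
  show ?case
    by (subst all_swap_actions[symmetric]) (simp add: inflow1_swap)
next
  case 3
  show ?case
    by (subst all_swap_actions[symmetric]) simp
next
  case 4
  show ?case
    by (subst all_swap_actions[symmetric]) simp
qed

text \<open>\<open>R\<close> is arbitrary because the objective ignores the plan; uses of the
  equation have to choose it.\<close>

lemma lp2_objective_eq_swap:
  "lp2_objective p (S, Z) = - lp1_objective p (R, \<lambda>I. - Z (swap_history I))"
  by (simp add: lp1_objective_def lp2_objective_def sum_negf)

lemma lp2_optimal_iff_swap:
  fixes G :: "'k::finite \<Rightarrow> 'l::finite \<Rightarrow> 'a::finite \<Rightarrow> 'b::finite \<Rightarrow> real"
  shows "lp2_optimal G P Q lam n p q S Z \<longleftrightarrow>
    lp1_optimal (\<lambda>l k b a. - G k l a b) (\<lambda>b a. Q a b) (\<lambda>b a. P a b) lam n q p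
      (\<lambda>J. S (swap_history J)) (\<lambda>I. - Z (swap_history I))" (is "_ \<longleftrightarrow> ?opt1")
proof -
  let ?feas1 = "lp1_feasible (\<lambda>l k b a. - G k l a b) (\<lambda>b a. Q a b) (\<lambda>b a. P a b) lam n q"
  have "(\<forall>S' Z'. lp2_feasible G P Q lam n q (S', Z') \<longrightarrow> lp2_objective p (S, Z) \<le> lp2_objective p (S', Z')) \<longleftrightarrow>
    (\<forall>R U. ?feas1 (R, U) \<longrightarrow>
      lp1_objective p (R, U) \<le> lp1_objective p (\<lambda>J. S (swap_history J), \<lambda>I. - Z (swap_history I)))"
    (is "?A \<longleftrightarrow> ?B")
  proof
    assume A: ?A
    show ?B
    proof (intro allI impI)
      fix R U assume "?feas1 (R, U)"
      then have "lp2_feasible G P Q lam n q (\<lambda>J. R (swap_history J), \<lambda>I. - U (swap_history I))"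
        by (simp add: lp2_feasible_iff_swap)
      then have "lp2_objective p (S, Z) \<le> lp2_objective p (\<lambda>J. R (swap_history J), \<lambda>I. - U (swap_history I))"
        using A by blast
      then show "lp1_objective p (R, U) \<le> lp1_objective p (\<lambda>J. S (swap_history J), \<lambda>I. - Z (swap_history I))"
        unfolding lp2_objective_eq_swap[where R = R]
          lp2_objective_eq_swap[where R = "\<lambda>J. S (swap_history J)"]
        by (simp add: lp1_objective_def)
    qed
  next
    assume B: ?B
    show ?A
    proof (intro allI impI)
      fix S' Z' assume "lp2_feasible G P Q lam n q (S', Z')"
      then have "lp1_objective p (\<lambda>J. S' (swap_history J), \<lambda>I. - Z' (swap_history I)) \<le>
          lp1_objective p (\<lambda>J. S (swap_history J), \<lambda>I. - Z (swap_history I))"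
        using B unfolding lp2_feasible_iff_swap by blast
      then show "lp2_objective p (S, Z) \<le> lp2_objective p (S', Z')"
        by (simp add: lp2_objective_def lp1_objective_def sum_negf)
    qed
  qed
  then show ?thesis
    unfolding lp1_optimal_def lp2_optimal_def is_arg_max_linorder is_arg_min_linorder split_paired_All
    using lp2_feasible_iff_swap by blast
qed

lemma optimal2_iff_swap:
  fixes G :: "'k::finite \<Rightarrow> 'l::finite \<Rightarrow> 'a::finite \<Rightarrow> 'b::finite \<Rightarrow> real"
  assumes "optimal1 (\<lambda>l k b a. - G k l a b) (\<lambda>b a. Q a b) (\<lambda>b a. P a b) lam n q p (\<lambda>J. \<tau> (swap_history J))"
  shows "optimal2 G P Q lam n p q \<tau>"
  using assms by (simp add: optimal1_def optimal2_def is_arg_max_linorder is_arg_min_linorder guarantee2_eq_swap)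

text \<open>Like \<open>alpha\<close> for player 1, \<open>beta\<close> is the guarantee of player 2
  when the opponent starts from a fixed state, so the exchange of players applies to it.\<close>

lemma mu_eq_swap:
  fixes G :: "'k::finite \<Rightarrow> 'l::finite \<Rightarrow> 'a::finite \<Rightarrow> 'b::finite \<Rightarrow> real"
  shows "mu G P Q lam n q \<tau> k = - nu (\<lambda>l k b a. - G k l a b) (\<lambda>b a. Q a b) (\<lambda>b a. P a b) lam n q
    (\<lambda>J. \<tau> (swap_history J)) k"
proof -
  have "beta G P Q lam n q \<tau> k = guarantee2 G P Q lam n (return_pmf k) q \<tau>"
    by (simp add: beta_def guarantee2_def)
  then show ?thesis by (simp add: mu_def nu_def alpha_def guarantee2_eq_swap guarantee1_def)
qed

lemma is_maximum_guarantee1_swap: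
  fixes G :: "'k::finite \<Rightarrow> 'l::finite \<Rightarrow> 'a::finite \<Rightarrow> 'b::finite \<Rightarrow> real"
  assumes "is_minimum (range (guarantee2 G P Q lam n p q)) v"
  shows "is_maximum (range (guarantee1 (\<lambda>l k b a. - G k l a b) (\<lambda>b a. Q a b) (\<lambda>b a. P a b) lam n q p)) (- v)"
proof -
  have eq: "guarantee1 (\<lambda>l k b a. - G k l a b) (\<lambda>b a. Q a b) (\<lambda>b a. P a b) lam n q p \<sigma>' =
      - guarantee2 G P Q lam n p q (\<lambda>J. \<sigma>' (swap_history J))" for \<sigma>'
    by (simp add: guarantee2_eq_swap)
  obtain \<tau> where \<tau>: "v = guarantee2 G P Q lam n p q \<tau>"
    using assms by (auto simp: is_minimum_def)
  have "guarantee1 (\<lambda>l k b a. - G k l a b) (\<lambda>b a. Q a b) (\<lambda>b a. P a b) lam n q p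
      (\<lambda>J. \<tau> (swap_history J)) = - v"
    by (simp add: eq \<tau>)
  then have "- v \<in> range (guarantee1 (\<lambda>l k b a. - G k l a b) (\<lambda>b a. Q a b) (\<lambda>b a. P a b) lam n q p)"
    by (metis rangeI)
  then show ?thesis using assms by (auto simp: is_maximum_def is_minimum_def eq)
qed

lemma lp2_minimum:
  fixes G :: "'k::finite \<Rightarrow> 'l::finite \<Rightarrow> 'a::finite \<Rightarrow> 'b::finite \<Rightarrow> real"
  assumes min: "is_minimum (range (guarantee2 G P Q lam n p q)) v"
  shows "is_minimum (lp2_objective p ` {x. lp2_feasible G P Q lam n q x}) v"
proof -
  let ?feas1 = "lp1_feasible (\<lambda>l k b a. - G k l a b) (\<lambda>b a. Q a b) (\<lambda>b a. P a b) lam n q"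
  have lp1: "is_maximum (lp1_objective p ` {x. ?feas1 x}) (- v)"
    by (rule lp1_maximum[OF is_maximum_guarantee1_swap[OF min]])
  then obtain R U where RU: "?feas1 (R, U)" "- v = lp1_objective p (R, U)"
    by (auto simp: is_maximum_def)
  have "lp2_feasible G P Q lam n q (\<lambda>J. R (swap_history J), \<lambda>I. - U (swap_history I))"
    using RU(1) by (simp add: lp2_feasible_iff_swap)
  moreover have "lp2_objective p (\<lambda>J. R (swap_history J), \<lambda>I. - U (swap_history I)) = v"
    using RU(2) by (simp add: lp2_objective_eq_swap[where R = R])
  ultimately have "v \<in> lp2_objective p ` {x. lp2_feasible G P Q lam n q x}"
    by (metis imageI mem_Collect_eq)
  moreover have "v \<le> lp2_objective p (S, Z)" if "lp2_feasible G P Q lam n q (S, Z)" for S Z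
  proof -
    have "lp1_objective p (\<lambda>J. S (swap_history J), \<lambda>I. - Z (swap_history I)) \<le> - v"
      using lp1 that unfolding lp2_feasible_iff_swap is_maximum_def by blast
    then show ?thesis by (simp add: lp2_objective_eq_swap[where R = "\<lambda>J. S (swap_history J)"])
  qed
  ultimately show ?thesis by (auto simp: is_minimum_def)
qed

text \<open>Everything is carried over from the program of the mirrored player 1; the witness
  \<open>Z'\<close> is the negated and relabelled \<open>U'\<close> obtained there.\<close>

lemma lp2_optimal_solution:
  fixes G :: "'k::finite \<Rightarrow> 'l::finite \<Rightarrow> 'a::finite \<Rightarrow> 'b::finite \<Rightarrow> real"
  assumes min: "is_minimum (range (guarantee2 G P Q lam n p q)) v"
    and opt: "lp2_optimal G P Q lam n p q S Z"
  shows "\<exists>\<tau>. induced2 Q n q S \<tau>"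
    and "induced2 Q n q S \<tau> \<Longrightarrow> optimal2 G P Q lam n p q \<tau>"
    and "induced2 Q n q S \<tau> \<Longrightarrow> pmf p k > 0 \<Longrightarrow> mu G P Q lam n q \<tau> k = - Z ([], k)"
    and "induced2 Q n q S \<tau> \<Longrightarrow> \<exists>Z'. lp2_optimal G P Q lam n p q S Z' \<and>
      (\<forall>k. mu G P Q lam n q \<tau> k = - Z' ([], k))"
proof -
  note lp1 = lp1_optimal_solution[OF is_maximum_guarantee1_swap[OF min] opt[unfolded lp2_optimal_iff_swap]]
  obtain \<sigma>' where "induced1 (\<lambda>b a. Q a b) n q (\<lambda>J. S (swap_history J)) \<sigma>'"
    using lp1(1) by blast
  then have "induced2 Q n q S (\<lambda>J. \<sigma>' (swap_history J))"
    by (simp add: induced2_iff_swap)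
  then show "\<exists>\<tau>. induced2 Q n q S \<tau>" by blast
  assume "induced2 Q n q S \<tau>"
  then have ind: "induced1 (\<lambda>b a. Q a b) n q (\<lambda>J. S (swap_history J)) (\<lambda>J. \<tau> (swap_history J))"
    by (simp add: induced2_iff_swap)
  show "optimal2 G P Q lam n p q \<tau>" by (rule optimal2_iff_swap[OF lp1(2)[OF ind]])
  show "mu G P Q lam n q \<tau> k = - Z ([], k)" if "pmf p k > 0"
    using lp1(3)[OF ind that] by (simp add: mu_eq_swap)
  obtain U' where U': "lp1_optimal (\<lambda>l k b a. - G k l a b) (\<lambda>b a. Q a b) (\<lambda>b a. P a b) lam n q p
      (\<lambda>J. S (swap_history J)) U'"
    "\<forall>k. nu (\<lambda>l k b a. - G k l a b) (\<lambda>b a. Q a b) (\<lambda>b a. P a b) lam n q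
      (\<lambda>J. \<tau> (swap_history J)) k = - U' ([], k)"
    using lp1(4)[OF ind] by blast
  show "\<exists>Z'. lp2_optimal G P Q lam n p q S Z' \<and> (\<forall>k. mu G P Q lam n q \<tau> k = - Z' ([], k))"
    using U' by (intro exI[of _ "\<lambda>I. - U' (swap_history I)"]) (simp add: lp2_optimal_iff_swap mu_eq_swap)
qed

theorem theorem1:
  fixes G :: "'k::finite \<Rightarrow> 'l::finite \<Rightarrow> 'a::finite \<Rightarrow> 'b::finite \<Rightarrow> real"
    and P :: "'a \<Rightarrow> 'b \<Rightarrow> 'k \<Rightarrow> 'k pmf"
    and Q :: "'a \<Rightarrow> 'b \<Rightarrow> 'l \<Rightarrow> 'l pmf"
    and p :: "'k pmf" and q :: "'l pmf"
    and lam :: real and n :: nat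
  assumes "\<And>k l a b. 0 \<le> G k l a b"
    and "1 \<le> n" and "0 < lam" and "lam \<le> 1"
  shows "has_value G P Q lam n p q (game_value G P Q lam n p q) \<and>
    is_maximum (lp1_objective q ` {x. lp1_feasible G P Q lam n p x})
      (game_value G P Q lam n p q) \<and>
    (\<forall>R U. lp1_optimal G P Q lam n p q R U \<longrightarrow>
       (\<exists>\<sigma>. induced1 P n p R \<sigma>) \<and>
       (\<forall>\<sigma>. induced1 P n p R \<sigma> \<longrightarrow>
          optimal1 G P Q lam n p q \<sigma> \<and>
          (\<forall>l. pmf q l > 0 \<longrightarrow> nu G P Q lam n p \<sigma> l = - U ([], l)) \<and>
          (\<exists>U'. lp1_optimal G P Q lam n p q R U' \<and>
             (\<forall>l. nu G P Q lam n p \<sigma> l = - U' ([], l))))) \<and>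
    is_minimum (lp2_objective p ` {x. lp2_feasible G P Q lam n q x})
      (game_value G P Q lam n p q) \<and>
    (\<forall>S Z. lp2_optimal G P Q lam n p q S Z \<longrightarrow>
       (\<exists>\<tau>. induced2 Q n q S \<tau>) \<and>
       (\<forall>\<tau>. induced2 Q n q S \<tau> \<longrightarrow>
          optimal2 G P Q lam n p q \<tau> \<and>
          (\<forall>k. pmf p k > 0 \<longrightarrow> mu G P Q lam n q \<tau> k = - Z ([], k)) \<and>
          (\<exists>Z'. lp2_optimal G P Q lam n p q S Z' \<and>
             (\<forall>k. mu G P Q lam n q \<tau> k = - Z' ([], k)))))"
proof -
  have v: "has_value G P Q lam n p q (game_value G P Q lam n p q)"
    by (rule has_value_game_value)
  then have
    max: "is_maximum (range (guarantee1 G P Q lam n p q)) (game_value G P Q lam n p q)" and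
    min: "is_minimum (range (guarantee2 G P Q lam n p q)) (game_value G P Q lam n p q)"
    by (simp_all add: has_value_def)
  show ?thesis
    by (intro conjI allI impI;
        (rule v lp1_maximum[OF max] lp2_minimum[OF min]
         | rule lp1_optimal_solution[OF max] lp2_optimal_solution[OF min]; assumption))
qed

end
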